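(* Let $d\ge 2$, let $\mathcal{Y}=\mathcal{C}\times_1\mathbf{U}_1\cdots\times_d\mathbf{U}_d\in\mathscr{M}_{\mathbf{r}}$ be a tensor of Tucker rank $\mathbf{r}=(r_1,\dots,r_d)^T$ with core $\mathcal{C}\in\mathbb{R}^{r_1\times\cdots\times r_d}$ and factor matrices $\mathbf{U}_n\in\mathbb{R}^{I_n\times r_n}$ having orthonormal columns, and let $\dot{\mathcal{A}}\in\mathbb{R}^{I_1\times\cdots\times I_d}$ be a given tensor (the value at a fixed time $t$ of the derivative of a time-dependent tensor). Then the optimization problem $$\min_{\dot{\mathcal{Y}}\in\mathscr{T}_{\mathcal{Y}}\mathscr{M}_{\mathbf{r}}}\|\dot{\mathcal{Y}}-\dot{\mathcal{A}}\|$$ is equivalent to $$\dot{\mathcal{Y}}=\dot{\mathcal{C}}\times_1\mathbf{U}_1\cdots\times_d\mathbf{U}_d+\sum_{n=1}^d\mathcal{C}\times_1\mathbf{U}_1\cdots\times_{n-1}\mathbf{U}_{n-1}\times_n\dot{\mathbf{U}}_n\times_{n+1}\mathbf{U}_{n+1}\cdots\times_d\mathbf{U}_d$$ with the core and the factors satisfying $$\dot{\mathcal{C}}=\dot{\mathcal{A}}\times_1\mathbf{U}_1^T\cdots\times_d\mathbf{U}_d^T-\sum_{k=1}^d\mathcal{C}\times_k\mathbf{U}_k^T\dot{\mathbf{U}}_k,$$ $$\dot{\mathbf{U}}_n=\Big(\Big[\dot{\mathcal{A}}\times_1\mathbf{U}_1^T\cdots\times_{n-1}\mathbf{U}_{n-1}^T\times_{n+1}\mathbf{U}_{n+1}^T\cdots\times_d\mathbf{U}_d^T\Big]_{(n)}-\mathbf{U}_n\dot{\mathbf{C}}_{(n)}-\mathbf{U}_n\sum_{k\ne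 n}\big[\mathcal{C}\times_k\mathbf{U}_k^T\dot{\mathbf{U}}_k\big]_{(n)}\Big)\mathbf{C}_{(n)}^T\big(\mathbf{C}_{(n)}\mathbf{C}_{(n)}^T\big)^{-1},\quad n=1,\dots,d.$$ That is, for $\dot{\mathcal{C}}\in\mathbb{R}^{r_1\times\cdots\times r_d}$ and $\dot{\mathbf{U}}_n\in\mathscr{T}_{\mathbf{U}_n}\mathcal{V}_{I_n,r_n}$ ($n=1,\dots,d$), the tangent tensor $\dot{\mathcal{Y}}$ given by the displayed representation is a minimizer if and only if $(\dot{\mathcal{C}},\dot{\mathbf{U}}_1,\dots,\dot{\mathbf{U}}_d)$ satisfies these equations. Moreover, if $\mathbf{U}_n^T\dot{\mathbf{U}}_n=0$ for $n=1,\dots,d$, these equations reduce to $$\dot{\mathcal{C}}=\dot{\mathcal{A}}\times_1\mathbf{U}_1^T\cdots\times_d\mathbf{U}_d^T,\qquad \dot{\mathbf{U}}_n=\big(\mathbf{I}-\mathbf{U}_n\mathbf{U}_n^T\big)\Big[\dot{\mathcal{A}}\times_1\mathbf{U}_1^T\cdots\times_{n-1}\mathbf{U}_{n-1}^T\times_{n+1}\mathbf{U}_{n+1}^T\cdots\times_d\mathbf{U}_d^T\Big]_{(n)}\mathbf{C}_{(n)}^T\big(\mathbf{C}_{(n)}\mathbf{C}_{(n)}^T\big)^{-1},\quad n=1,\dots,d.$$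
   Context: All tensors and matrices are real. For tensors, $\langle\mathcal{X},\mathcal{Y}\rangle$ is the sum of products of corresponding entries and $\|\mathcal{X}\|^2=\langle\mathcal{X},\mathcal{X}\rangle$; for matrices these are the Frobenius inner product and norm. The $n$th unfolding $[\mathcal{X}]_{(n)}=\mathbf{X}_{(n)}\in\mathbb{R}^{I_n\times\prod_{j\ne n}I_j}$ of $\mathcal{X}\in\mathbb{R}^{I_1\times\cdots\times I_d}$ is the matrix whose columns are the mode-$n$ fibers of $\mathcal{X}$ (all indices fixed except the $n$th), in a fixed ordering depending only on the indices. In particular $\mathbf{C}_{(n)}=[\mathcal{C}]_{(n)}$ and $\dot{\mathbf{C}}_{(n)}=[\dot{\mathcal{C}}]_{(n)}$. The $n$-mode product $\mathcal{X}\times_n\mathbf{U}$ with a matrix $\mathbf{U}\in\mathbb{R}^{J_n\times I_n}$ is the tensor defined by $[\mathcal{X}\times_n\mathbf{U}]_{(n)}=\mathbf{U}\mathbf{X}_{(n)}$; products in different modes commute. The notation $\mathcal{X}\times_1\mathbf{U}_1\cdots\times_d\mathbf{U}_d$ means the successive mode products over all modes $1,\dots,d$, and $\mathcal{X}\times_1\mathbf{U}_1\cdots\times_{n-1}\mathbf{U}_{n-1}\times_{n+1}\mathbf{U}_{n+1}\cdots\times_d\mathbf{U}_d$ means the product over all modes except $n$. $\mathscr{M}_{\mathbf{r}}=\{\mathcal{X}\in\mathbb{R}^{I_1\times\cdots\times I_d}:\ \mathrm{rank}(\mathbf{X}_{(n)})=r_n,\ n=1,\dots,d\}$ is the manifold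 of tensors of Tucker rank $\mathbf{r}$. Every element has a Tucker decomposition $\mathcal{C}\times_1\mathbf{U}_1\cdots\times_d\mathbf{U}_d$ with core $\mathcal{C}\in\mathbb{R}^{r_1\times\cdots\times r_d}$ and $\mathbf{U}_k^T\mathbf{U}_k=\mathbf{I}$. $\mathcal{V}_{I,r}$ is the Stiefel manifold of real $I\times r$ matrices with orthonormal columns, with tangent space $\mathscr{T}_{\mathbf{U}}\mathcal{V}_{I,r}=\{\dot{\mathbf{U}}\in\mathbb{R}^{I\times r}:\dot{\mathbf{U}}^T\mathbf{U}+\mathbf{U}^T\dot{\mathbf{U}}=0\}$. The tangent space $\mathscr{T}_{\mathcal{Y}}\mathscr{M}_{\mathbf{r}}$ at $\mathcal{Y}=\mathcal{C}\times_1\mathbf{U}_1\cdots\times_d\mathbf{U}_d$ consists of all tensors $\dot{\mathcal{C}}\times_1\mathbf{U}_1\cdots\times_d\mathbf{U}_d+\sum_{n=1}^d\mathcal{C}\times_1\mathbf{U}_1\cdots\times_{n-1}\mathbf{U}_{n-1}\times_n\dot{\mathbf{U}}_n\times_{n+1}\mathbf{U}_{n+1}\cdots\times_d\mathbf{U}_d$ with $\dot{\mathcal{C}}\in\mathbb{R}^{r_1\times\cdots\times r_d}$ and $\dot{\mathbf{U}}_n\in\mathscr{T}_{\mathbf{U}_n}\mathcal{V}_{I_n,r_n}$. *)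

theory Defs
  imports
    "HOL-Library.Function_Algebras"
    "Jordan_Normal_Form.Gauss_Jordan_Elimination"
    "Jordan_Normal_Form.DL_Rank"
begin

text \<open>
  Modes and indices are counted from 0.  A tensor of size \<open>ds ! 0 \<times> \<dots> \<times> ds ! (d - 1)\<close> is a
  function on index lists that is zero outside the index range, so that equality of tensors is
  equality of functions and the linear structure is the pointwise one.
\<close>

type_synonym tensor = "nat list \<Rightarrow> real"

definition multi_indices :: "nat list \<Rightarrow> nat list set" where
  "multi_indices ds = {is. list_all2 (<) is ds}"

definition tensors :: "nat list \<Rightarrow> tensor set" where
  "tensors ds = {X. \<forall>is. is \<notin> multi_indices ds \<longrightarrow> X is = 0}"

definition tensor_inner :: "nat list \<Rightarrow> tensor \<Rightarrow> tensor \<Rightarrow> real" where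
  "tensor_inner ds X Y = (\<Sum>is\<in>multi_indices ds. X is * Y is)"

definition tensor_norm :: "nat list \<Rightarrow> tensor \<Rightarrow> real" where
  "tensor_norm ds X = sqrt (tensor_inner ds X X)"

definition del_mode :: "nat \<Rightarrow> nat list \<Rightarrow> nat list" where
  "del_mode n xs = take n xs @ drop (Suc n) xs"

definition ins_mode :: "nat \<Rightarrow> nat \<Rightarrow> nat list \<Rightarrow> nat list" where
  "ins_mode n i xs = take n xs @ i # drop n xs"

text \<open>
  The order of the columns of an unfolding: an arbitrary enumeration of the multi-indices of the
  remaining modes, fixed once and for all and depending only on the sizes of these modes.
\<close>

definition enum_indices :: "nat list \<Rightarrow> nat \<Rightarrow> nat list" where
  "enum_indices ds = (SOME e. bij_betw e {..<prod_list ds} (multi_indices ds))"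

definition unfolding_mat :: "nat list \<Rightarrow> nat \<Rightarrow> tensor \<Rightarrow> real mat" where
  "unfolding_mat ds n X =
     mat (ds ! n) (prod_list (del_mode n ds))
       (\<lambda>(i, c). X (ins_mode n i (enum_indices (del_mode n ds) c)))"

text \<open>
  The mode product, entry by entry.  For a tensor of size \<open>ds\<close> and a matrix with \<open>ds ! n\<close> columns
  it is the unique tensor whose unfolding in mode \<open>n\<close> is the matrix times the unfolding of the
  given tensor: see \<open>unfolding_mode_prod\<close>, \<open>mode_prod_closed\<close> and \<open>unfolding_mat_inject\<close> below.
\<close>

definition mode_prod :: "tensor \<Rightarrow> nat \<Rightarrow> real mat \<Rightarrow> tensor" where
  "mode_prod X n U = (\<lambda>is.
     if n < length is \<and> is ! n < dim_row U
     then \<Sum>j<dim_col U. U $$ (is ! n, j) * X (is[n := j]) else 0)"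

definition mode_prods :: "tensor \<Rightarrow> nat list \<Rightarrow> (nat \<Rightarrow> real mat) \<Rightarrow> tensor" where
  "mode_prods X ns U = fold (\<lambda>n Z. mode_prod Z n (U n)) ns X"

definition all_modes_prod :: "nat \<Rightarrow> tensor \<Rightarrow> (nat \<Rightarrow> real mat) \<Rightarrow> tensor" where
  "all_modes_prod d X U = mode_prods X [0..<d] U"

definition other_modes_prod :: "nat \<Rightarrow> nat \<Rightarrow> tensor \<Rightarrow> (nat \<Rightarrow> real mat) \<Rightarrow> tensor" where
  "other_modes_prod d n X U = mode_prods X ([0..<n] @ [Suc n..<d]) U"

definition tucker_manifold :: "nat list \<Rightarrow> nat list \<Rightarrow> tensor set" where
  "tucker_manifold Is rs =
     {X \<in> tensors Is. \<forall>n<length Is. vec_space.rank (Is ! n) (unfolding_mat Is n X) = rs ! n}"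

definition stiefel :: "nat \<Rightarrow> nat \<Rightarrow> real mat set" where
  "stiefel I r = {U \<in> carrier_mat I r. U\<^sup>T * U = 1\<^sub>m r}"

definition stiefel_tangent :: "nat \<Rightarrow> nat \<Rightarrow> real mat \<Rightarrow> real mat set" where
  "stiefel_tangent I r U = {V \<in> carrier_mat I r. V\<^sup>T * U + U\<^sup>T * V = 0\<^sub>m r r}"

definition tangent_tensor ::
  "nat \<Rightarrow> tensor \<Rightarrow> (nat \<Rightarrow> real mat) \<Rightarrow> tensor \<Rightarrow> (nat \<Rightarrow> real mat) \<Rightarrow> tensor" where
  "tangent_tensor d C U dC dU =
     all_modes_prod d dC U + (\<Sum>n<d. all_modes_prod d C (U(n := dU n)))"

text \<open>The tangent space at the point \<open>all_modes_prod (length Is) C U\<close>.\<close>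

definition tucker_tangent_space ::
  "nat list \<Rightarrow> nat list \<Rightarrow> tensor \<Rightarrow> (nat \<Rightarrow> real mat) \<Rightarrow> tensor set" where
  "tucker_tangent_space Is rs C U =
     {tangent_tensor (length Is) C U dC dU | dC dU.
        dC \<in> tensors rs \<and>
        (\<forall>n<length Is. dU n \<in> stiefel_tangent (Is ! n) (rs ! n) (U n))}"

definition core_eq ::
  "nat \<Rightarrow> tensor \<Rightarrow> (nat \<Rightarrow> real mat) \<Rightarrow> tensor \<Rightarrow> tensor \<Rightarrow> (nat \<Rightarrow> real mat) \<Rightarrow> bool" where
  "core_eq d C U A dC dU \<longleftrightarrow>
     dC = all_modes_prod d A (\<lambda>k. (U k)\<^sup>T) - (\<Sum>k<d. mode_prod C k ((U k)\<^sup>T * dU k))"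

text \<open>
  The matrix under \<open>mat_inverse\<close> is invertible whenever \<open>all_modes_prod d C U\<close> has Tucker rank \<open>rs\<close>
  and the \<open>U n\<close> have orthonormal columns; the size of the unfolded projection of \<open>A\<close> is \<open>rs\<close> with
  entry \<open>n\<close> replaced by \<open>Is ! n\<close>.
\<close>

definition factor_eq ::
  "nat list \<Rightarrow> nat list \<Rightarrow> tensor \<Rightarrow> (nat \<Rightarrow> real mat) \<Rightarrow> tensor \<Rightarrow> tensor \<Rightarrow> (nat \<Rightarrow> real mat) \<Rightarrow>
     nat \<Rightarrow> bool" where
  "factor_eq Is rs C U A dC dU n \<longleftrightarrow>
     dU n =
       (unfolding_mat (rs[n := Is ! n]) n (other_modes_prod (length Is) n A (\<lambda>k. (U k)\<^sup>T))
         - U n * unfolding_mat rs n dC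
         - U n * (\<Oplus>\<^bsub>module_mat TYPE(real) (rs ! n) (prod_list (del_mode n rs))\<^esub>
                    k\<in>{..<length Is} - {n}. unfolding_mat rs n (mode_prod C k ((U k)\<^sup>T * dU k))))
       * (unfolding_mat rs n C)\<^sup>T
       * the (mat_inverse (unfolding_mat rs n C * (unfolding_mat rs n C)\<^sup>T))"

definition reduced_core_eq ::
  "nat \<Rightarrow> (nat \<Rightarrow> real mat) \<Rightarrow> tensor \<Rightarrow> tensor \<Rightarrow> bool" where
  "reduced_core_eq d U A dC \<longleftrightarrow> dC = all_modes_prod d A (\<lambda>k. (U k)\<^sup>T)"

definition reduced_factor_eq ::
  "nat list \<Rightarrow> nat list \<Rightarrow> tensor \<Rightarrow> (nat \<Rightarrow> real mat) \<Rightarrow> tensor \<Rightarrow> (nat \<Rightarrow> real mat) \<Rightarrow>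
     nat \<Rightarrow> bool" where
  "reduced_factor_eq Is rs C U A dU n \<longleftrightarrow>
     dU n =
       (1\<^sub>m (Is ! n) - U n * (U n)\<^sup>T)
       * unfolding_mat (rs[n := Is ! n]) n (other_modes_prod (length Is) n A (\<lambda>k. (U k)\<^sup>T))
       * (unfolding_mat rs n C)\<^sup>T
       * the (mat_inverse (unfolding_mat rs n C * (unfolding_mat rs n C)\<^sup>T))"

lemma multi_indices_Nil: "multi_indices [] = {[]}"
  by (auto simp: multi_indices_def)

lemma multi_indices_Cons:
  "multi_indices (k # ds) = (\<lambda>(i, is). i # is) ` ({..<k} \<times> multi_indices ds)"
  by (auto simp: multi_indices_def list_all2_Cons2 image_iff)

lemma finite_multi_indices: "finite (multi_indices ds)"
  by (induction ds) (auto simp: multi_indices_Nil multi_indices_Cons)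

lemma card_multi_indices: "card (multi_indices ds) = prod_list ds"
proof (induction ds)
  case (Cons k ds)
  have "inj_on (\<lambda>(i, is). i # is) ({..<k} \<times> multi_indices ds)"
    by (auto simp: inj_on_def)
  then show ?case
    using Cons by (simp add: multi_indices_Cons card_image card_cartesian_product)
qed (simp add: multi_indices_Nil)

lemma bij_betw_enum_indices:
  "bij_betw (enum_indices ds) {..<prod_list ds} (multi_indices ds)"
proof -
  from ex_bij_betw_nat_finite[OF finite_multi_indices[of ds]]
  have "\<exists>e. bij_betw e {..<prod_list ds} (multi_indices ds)"
    by (simp add: card_multi_indices lessThan_atLeast0)
  then show ?thesis
    unfolding enum_indices_def by (rule someI_ex)
qed

lemma enum_indices_mem: "c < prod_list ds \<Longrightarrow> enum_indices ds c \<in> multi_indices ds"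
  using bij_betw_enum_indices[of ds] by (auto simp: bij_betw_def)

lemma ins_mode_nth [simp]: "n \<le> length xs \<Longrightarrow> ins_mode n i xs ! n = i"
  by (simp add: ins_mode_def nth_append)

lemma ins_mode_length [simp]: "length (ins_mode n i xs) = Suc (length xs)"
  by (simp add: ins_mode_def)

lemma ins_mode_update [simp]: "n \<le> length xs \<Longrightarrow> (ins_mode n i xs)[n := j] = ins_mode n j xs"
  by (simp add: ins_mode_def list_update_append)

lemma ins_mode_del_mode: "n < length xs \<Longrightarrow> ins_mode n (xs ! n) (del_mode n xs) = xs"
  by (simp add: ins_mode_def del_mode_def Cons_nth_drop_Suc)

lemma del_mode_update [simp]: "del_mode n (xs[n := j]) = del_mode n xs"
  by (simp add: del_mode_def)

lemma length_del_mode: "n < length xs \<Longrightarrow> length (del_mode n xs) = length xs - 1"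
  by (simp add: del_mode_def)

lemma multi_indices_length: "is \<in> multi_indices ds \<Longrightarrow> length is = length ds"
  by (auto simp: multi_indices_def list_all2_lengthD)

lemma del_mode_mem:
  "is \<in> multi_indices ds \<Longrightarrow> del_mode n is \<in> multi_indices (del_mode n ds)"
  unfolding multi_indices_def del_mode_def
  by (auto intro!: list_all2_appendI list_all2_takeI list_all2_dropI)

lemma mode_prod_closed:
  assumes "X \<in> tensors ds" "n < length ds" "U \<in> carrier_mat m (ds ! n)"
  shows "mode_prod X n U \<in> tensors (ds[n := m])"
proof -
  have "mode_prod X n U is = 0" if out: "is \<notin> multi_indices (ds[n := m])" for "is"
  proof (cases "n < length is \<and> is ! n < m")
    case True
    have "is[n := j] \<notin> multi_indices ds" for j
    proof
      assume "is[n := j] \<in> multi_indices ds"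
      then have "list_all2 (<) (is[n := j, n := is ! n]) (ds[n := m])"
        using True unfolding multi_indices_def
        by (intro list_all2_update_cong) auto
      with out show False by (simp add: multi_indices_def)
    qed
    then show ?thesis
      using assms(1) by (simp add: mode_prod_def tensors_def)
  next
    case False
    then show ?thesis
      using assms(3) by (auto simp: mode_prod_def)
  qed
  then show ?thesis by (auto simp: tensors_def)
qed

lemma unfolding_mode_prod:
  assumes "n < length ds" "U \<in> carrier_mat m (ds ! n)"
  shows "unfolding_mat (ds[n := m]) n (mode_prod X n U) = U * unfolding_mat ds n X"
proof (rule eq_matI)
  fix i c
  assume "i < dim_row (U * unfolding_mat ds n X)" "c < dim_col (U * unfolding_mat ds n X)"
  then have i: "i < m" and c: "c < prod_list (del_mode n ds)"
    using assms by (auto simp: unfolding_mat_def)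
  let ?e = "enum_indices (del_mode n ds) c"
  have "length ?e = length ds - 1"
    using multi_indices_length[OF enum_indices_mem[OF c]] length_del_mode[OF assms(1)] by simp
  then have le: "n \<le> length ?e"
    using assms(1) by simp
  have "unfolding_mat (ds[n := m]) n (mode_prod X n U) $$ (i, c) =
      (\<Sum>j<ds ! n. U $$ (i, j) * X (ins_mode n j ?e))"
    using assms i c le by (simp add: unfolding_mat_def mode_prod_def)
  also have "\<dots> = (U * unfolding_mat ds n X) $$ (i, c)"
    using assms i c by (simp add: unfolding_mat_def scalar_prod_def lessThan_atLeast0)
  finally show "unfolding_mat (ds[n := m]) n (mode_prod X n U) $$ (i, c) =
      (U * unfolding_mat ds n X) $$ (i, c)" .
qed (use assms in \<open>auto simp: unfolding_mat_def\<close>)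

lemma unfolding_mat_inject:
  assumes "n < length ds" "X \<in> tensors ds" "Y \<in> tensors ds"
    and eq: "unfolding_mat ds n X = unfolding_mat ds n Y"
  shows "X = Y"
proof
  fix "is"
  show "X is = Y is"
  proof (cases "is \<in> multi_indices ds")
    case True
    then have n: "n < length is" and i: "is ! n < ds ! n"
      using assms(1) by (auto simp: multi_indices_def list_all2_conv_all_nth)
    from del_mode_mem[OF True, of n] obtain c
      where c: "c < prod_list (del_mode n ds)" "enum_indices (del_mode n ds) c = del_mode n is"
      using bij_betw_enum_indices[of "del_mode n ds"]
      unfolding bij_betw_def by (metis imageE lessThan_iff)
    have "unfolding_mat ds n Z $$ (is ! n, c) = Z is" for Z
      using i c n by (simp add: unfolding_mat_def ins_mode_del_mode)
    then show ?thesis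
      using eq by metis
  next
    case False
    then show ?thesis
      using assms(2,3) by (simp add: tensors_def)
  qed
qed

end

theory Submission
  imports Defs
begin

text \<open>
  The tangent space is linear, so \<open>Y'\<close> minimizes the distance to \<open>A\<close> iff the residual \<open>R = Y' - A\<close> is
  orthogonal to it.  The adjoint of a mode product is the mode product with the transpose; testing
  with core variations gives \<open>R \<times>\<^sub>1 U\<^sub>1\<^sup>T \<dots> \<times>\<^sub>d U\<^sub>d\<^sup>T = 0\<close>, the core equation, and testing with variations of
  the \<open>n\<close>-th factor gives \<open>[R \<times>\<^bsub>k\<noteq>n\<^esub> U\<^sub>k\<^sup>T]\<^sub>(\<^sub>n\<^sub>) C\<^sub>(\<^sub>n\<^sub>)\<^sup>T = 0\<close>, the normal equation of the factor.  It can be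
  solved for the derivative of the factor because the rank condition makes the Gram matrix of the
  unfolded core invertible.
\<close>

section \<open>Mode products\<close>

text \<open>Two obstacles shape the argument. The admissible variations \<open>V\<close> of the
  factor in mode \<open>n\<close> are only those with skew-symmetric
  \<open>(U n)\<^sup>T * V\<close>, whereas the normal equation is that of an unconstrained least
  squares problem. The gap closes because a variation \<open>U n * S\<close> has the same effect as
  the change \<open>mode_prod C n S\<close> of the core, and changes of the core are unrestricted.
  By the same redundancy a tangent tensor has many parameters \<open>dC\<close>, \<open>dU\<close>;
  the equivalence holds for every choice of them, as both conditions are read off the residual. The
  second obstacle is that the rank is prescribed for the unfoldings of the full tensor, while the
  matrix to be inverted is built from the core. The link is a left null vector of the unfolded core,
  which survives the products in all other modes.\<close>

lemma mode_prod_apply: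
  "mode_prod X n U is = (if n < length is \<and> is ! n < dim_row U
     then \<Sum>j<dim_col U. U $$ (is ! n, j) * X (is[n := j]) else 0)"
  by (simp add: mode_prod_def)

lemma sum_apply: "(\<Sum>k\<in>K. F k) is = (\<Sum>k\<in>K. F k is)" for F :: "'b \<Rightarrow> tensor"
  by (induction K rule: infinite_finite_induct) auto

lemma mode_prod_zero_left: "mode_prod 0 n U = 0"
  by (rule ext) (simp add: mode_prod_apply)

lemma mode_prod_zero_right: "mode_prod X n (0\<^sub>m a b) = 0"
  by (rule ext) (simp add: mode_prod_apply)

lemma mode_prod_add_left: "mode_prod (X + Y) n U = mode_prod X n U + mode_prod Y n U"
  by (rule ext) (simp add: mode_prod_apply distrib_left sum.distrib)

lemma mode_prod_diff_left: "mode_prod (X - Y) n U = mode_prod X n U - mode_prod Y n U"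
  by (rule ext) (simp add: mode_prod_apply right_diff_distrib sum_subtractf)

lemma mode_prod_scale_left: "mode_prod (\<lambda>is. t * X is) n U = (\<lambda>is. t * mode_prod X n U is)"
  by (rule ext) (simp add: mode_prod_apply sum_distrib_left mult.left_commute)

lemma mode_prod_sum_left: "mode_prod (\<Sum>k\<in>K. F k) n U = (\<Sum>k\<in>K. mode_prod (F k) n U)"
  by (induction K rule: infinite_finite_induct)
     (simp_all only: sum.infinite sum.empty sum.insert mode_prod_zero_left mode_prod_add_left simp_thms)

lemma mode_prod_add_right:
  assumes "U \<in> carrier_mat a b" "V \<in> carrier_mat a b"
  shows "mode_prod X n (U + V) = mode_prod X n U + mode_prod X n V"
  using assms by (intro ext) (auto simp: mode_prod_apply distrib_right sum.distrib)

lemma mode_prod_smult_right: "mode_prod X n (t \<cdot>\<^sub>m U) = (\<lambda>is. t * mode_prod X n U is)"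
  by (rule ext) (auto simp: mode_prod_apply sum_distrib_left mult.assoc)

lemma mode_prod_mode_prod:
  assumes "dim_col V = dim_row U"
  shows "mode_prod (mode_prod X n U) n V = mode_prod X n (V * U)"
proof
  fix "is"
  show "mode_prod (mode_prod X n U) n V is = mode_prod X n (V * U) is"
  proof (cases "n < length is \<and> is ! n < dim_row V")
    case True
    have "mode_prod (mode_prod X n U) n V is =
        (\<Sum>j<dim_row U. \<Sum>l<dim_col U. V $$ (is ! n, j) * (U $$ (j, l) * X (is[n := l])))"
      using True assms by (simp add: mode_prod_apply sum_distrib_left)
    also have "\<dots> = (\<Sum>l<dim_col U. \<Sum>j<dim_row U. V $$ (is ! n, j) * (U $$ (j, l) * X (is[n := l])))"
      by (rule sum.swap)
    also have "\<dots> = (\<Sum>l<dim_col U. (V * U) $$ (is ! n, l) * X (is[n := l]))"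
    proof (rule sum.cong[OF refl])
      fix l assume "l \<in> {..<dim_col U}"
      then have "(V * U) $$ (is ! n, l) = (\<Sum>j<dim_row U. V $$ (is ! n, j) * U $$ (j, l))"
        using True assms by (simp add: scalar_prod_def lessThan_atLeast0)
      then show "(\<Sum>j<dim_row U. V $$ (is ! n, j) * (U $$ (j, l) * X (is[n := l]))) =
          (V * U) $$ (is ! n, l) * X (is[n := l])"
        by (simp only: sum_distrib_right mult.assoc)
    qed
    also have "\<dots> = mode_prod X n (V * U) is"
      using True by (simp add: mode_prod_apply)
    finally show ?thesis .
  qed (auto simp: mode_prod_apply)
qed

text \<open>Index updates at different positions commute, so both sides are one double sum with the
  order of summation exchanged.\<close>

lemma mode_prod_commute:
  assumes "n \<noteq> m"
  shows "mode_prod (mode_prod X n U) m V = mode_prod (mode_prod X m V) n U"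
proof
  fix "is"
  show "mode_prod (mode_prod X n U) m V is = mode_prod (mode_prod X m V) n U is"
  proof (cases "n < length is \<and> is ! n < dim_row U \<and> m < length is \<and> is ! m < dim_row V")
    case True
    have "mode_prod (mode_prod X n U) m V is =
        (\<Sum>j<dim_col V. \<Sum>l<dim_col U. V $$ (is ! m, j) * (U $$ (is ! n, l) * X (is[m := j, n := l])))"
      using True assms by (simp add: mode_prod_apply sum_distrib_left)
    also have "\<dots> = (\<Sum>l<dim_col U. \<Sum>j<dim_col V. V $$ (is ! m, j) * (U $$ (is ! n, l) * X (is[m := j, n := l])))"
      by (rule sum.swap)
    also have "\<dots> = (\<Sum>l<dim_col U. \<Sum>j<dim_col V. U $$ (is ! n, l) * (V $$ (is ! m, j) * X (is[n := l, m := j])))"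
      using assms by (simp add: list_update_swap mult.left_commute)
    also have "\<dots> = mode_prod (mode_prod X m V) n U is"
      using True assms by (simp add: mode_prod_apply sum_distrib_left)
    finally show ?thesis .
  qed (use assms in \<open>auto simp: mode_prod_apply\<close>)
qed

text \<open>Within the range of mode \<open>n\<close> the sum collapses to its diagonal term.
  Outside it the product is zero by convention, which agrees with \<open>X\<close> because tensors
  vanish outside their index range.\<close>

lemma mode_prod_one:
  assumes "X \<in> tensors ds" "n < length ds"
  shows "mode_prod X n (1\<^sub>m (ds ! n)) = X"
proof
  fix "is"
  show "mode_prod X n (1\<^sub>m (ds ! n)) is = X is"
  proof (cases "n < length is \<and> is ! n < ds ! n")
    case True
    then have "mode_prod X n (1\<^sub>m (ds ! n)) is =
        (\<Sum>j<ds ! n. 1\<^sub>m (ds ! n) $$ (is ! n, j) * X (is[n := j]))"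
      by (simp add: mode_prod_apply)
    also have "\<dots> = (\<Sum>j<ds ! n. if is ! n = j then X (is[n := j]) else 0)"
      using True by (intro sum.cong) auto
    finally have "mode_prod X n (1\<^sub>m (ds ! n)) is =
        (\<Sum>j<ds ! n. if is ! n = j then X (is[n := j]) else 0)" .
    then show ?thesis using True by simp
  next
    case False
    then have "is \<notin> multi_indices ds"
      using assms(2) by (auto simp: multi_indices_def list_all2_conv_all_nth)
    then show ?thesis
      using assms(1) False by (auto simp: mode_prod_apply tensors_def)
  qed
qed

section \<open>Splitting off one mode, and the adjoint of a mode product\<close>

lemma del_mode_ins_mode: "n \<le> length xs \<Longrightarrow> del_mode n (ins_mode n i xs) = xs"
  by (simp add: del_mode_def ins_mode_def)

lemma bij_betw_ins_mode:
  assumes "n < length ds"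
  shows "bij_betw (\<lambda>(i, e). ins_mode n i e) ({..<ds ! n} \<times> multi_indices (del_mode n ds)) (multi_indices ds)"
proof (rule bij_betw_byWitness[where f' = "\<lambda>is. (is ! n, del_mode n is)"])
  have len: "n \<le> length e" if "e \<in> multi_indices (del_mode n ds)" for e
    using multi_indices_length[OF that] length_del_mode[OF assms] assms by simp
  show "\<forall>a\<in>{..<ds ! n} \<times> multi_indices (del_mode n ds).
      (\<lambda>is. (is ! n, del_mode n is)) ((\<lambda>(i, e). ins_mode n i e) a) = a"
    using len by (auto simp: del_mode_ins_mode)
  show "\<forall>a'\<in>multi_indices ds. (\<lambda>(i, e). ins_mode n i e) (a' ! n, del_mode n a') = a'"
    using assms by (auto dest!: multi_indices_length simp: ins_mode_del_mode)
  show "(\<lambda>(i, e). ins_mode n i e) ` ({..<ds ! n} \<times> multi_indices (del_mode n ds)) \<subseteq> multi_indices ds"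
  proof clarsimp
    fix i e assume i: "i < ds ! n" and e: "e \<in> multi_indices (del_mode n ds)"
    have "list_all2 (<) (take n e @ i # drop n e) (take n ds @ ds ! n # drop (Suc n) ds)"
    proof (rule list_all2_appendI)
      from e have *: "list_all2 (<) e (take n ds @ drop (Suc n) ds)"
        by (simp add: multi_indices_def del_mode_def)
      show "list_all2 (<) (take n e) (take n ds)"
        using list_all2_takeI[OF *, of n] assms by simp
      show "list_all2 (<) (i # drop n e) (ds ! n # drop (Suc n) ds)"
        using list_all2_dropI[OF *, of n] assms i by simp
    qed
    then show "ins_mode n i e \<in> multi_indices ds"
      using assms by (simp add: multi_indices_def ins_mode_def id_take_nth_drop[symmetric])
  qed
  show "(\<lambda>is. (is ! n, del_mode n is)) ` multi_indices ds \<subseteq> {..<ds ! n} \<times> multi_indices (del_mode n ds)"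
  proof (rule image_subsetI)
    fix "is" assume "is": "is \<in> multi_indices ds"
    then have "is ! n < ds ! n"
      using assms by (simp add: multi_indices_def list_all2_conv_all_nth)
    with del_mode_mem[OF "is"] show "(is ! n, del_mode n is) \<in> {..<ds ! n} \<times> multi_indices (del_mode n ds)"
      by simp
  qed
qed

lemma sum_multi_indices_split:
  assumes "n < length ds"
  shows "(\<Sum>is\<in>multi_indices ds. f is) =
    (\<Sum>i<ds ! n. \<Sum>e\<in>multi_indices (del_mode n ds). f (ins_mode n i e))"
  unfolding sum.cartesian_product
  using sum.reindex_bij_betw[OF bij_betw_ins_mode[OF assms], of f, symmetric]
  by (simp add: case_prod_unfold)

text \<open>Once mode \<open>n\<close> is split off, both sides sum over the same remaining indices,
  since \<open>del_mode n\<close> ignores the resized entry; what is left is an exchange of the two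
  sums that run over mode \<open>n\<close>.\<close>

lemma tensor_inner_adjoint:
  assumes "n < length ds" "U \<in> carrier_mat m (ds ! n)"
  shows "tensor_inner (ds[n := m]) (mode_prod X n U) Z = tensor_inner ds X (mode_prod Z n U\<^sup>T)"
proof -
  let ?E = "multi_indices (del_mode n ds)"
  have len: "n \<le> length e" "n < Suc (length e)" if "e \<in> ?E" for e
    using multi_indices_length[OF that] length_del_mode[OF assms(1)] assms(1) by auto
  have "tensor_inner (ds[n := m]) (mode_prod X n U) Z =
      (\<Sum>i<m. \<Sum>e\<in>?E. (\<Sum>j<ds ! n. U $$ (i, j) * X (ins_mode n j e)) * Z (ins_mode n i e))"
    unfolding tensor_inner_def using assms len
    by (subst sum_multi_indices_split[where n = n]) (auto simp: mode_prod_apply intro!: sum.cong)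
  also have "\<dots> = (\<Sum>i<m. \<Sum>e\<in>?E. \<Sum>j<ds ! n. U $$ (i, j) * X (ins_mode n j e) * Z (ins_mode n i e))"
    by (simp add: sum_distrib_right)
  also have "\<dots> = (\<Sum>i<m. \<Sum>j<ds ! n. \<Sum>e\<in>?E. U $$ (i, j) * X (ins_mode n j e) * Z (ins_mode n i e))"
    by (intro sum.cong[OF refl] sum.swap)
  also have "\<dots> = (\<Sum>j<ds ! n. \<Sum>i<m. \<Sum>e\<in>?E. U $$ (i, j) * X (ins_mode n j e) * Z (ins_mode n i e))"
    by (rule sum.swap)
  also have "\<dots> = (\<Sum>j<ds ! n. \<Sum>e\<in>?E. \<Sum>i<m. U $$ (i, j) * X (ins_mode n j e) * Z (ins_mode n i e))"
    by (intro sum.cong[OF refl] sum.swap)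
  also have "\<dots> = (\<Sum>j<ds ! n. \<Sum>e\<in>?E. X (ins_mode n j e) * (\<Sum>i<m. U $$ (i, j) * Z (ins_mode n i e)))"
    by (simp add: sum_distrib_left mult_ac)
  also have "\<dots> = tensor_inner ds X (mode_prod Z n U\<^sup>T)"
    unfolding tensor_inner_def using assms len
    by (subst sum_multi_indices_split[where n = n]) (auto simp: mode_prod_apply intro!: sum.cong)
  finally show ?thesis .
qed

section \<open>Successive mode products and the sizes they produce\<close>

lemma mode_prods_Nil [simp]: "mode_prods X [] U = X"
  by (simp add: mode_prods_def)

lemma mode_prods_Cons [simp]: "mode_prods X (n # ns) U = mode_prods (mode_prod X n (U n)) ns U"
  by (simp add: mode_prods_def)

lemma mode_prods_append [simp]: "mode_prods X (ns @ ms) U = mode_prods (mode_prods X ns U) ms U"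
  by (simp add: mode_prods_def)

lemma mode_prods_cong: "(\<And>k. k \<in> set ns \<Longrightarrow> U k = V k) \<Longrightarrow> mode_prods X ns U = mode_prods X ns V"
  by (induction ns arbitrary: X) auto

lemma mode_prods_mode_prod:
  "n \<notin> set ns \<Longrightarrow> mode_prods (mode_prod X n V) ns U = mode_prod (mode_prods X ns U) n V"
proof (induction ns arbitrary: X)
  case (Cons m ns)
  then have "mode_prod (mode_prod X n V) m (U m) = mode_prod (mode_prod X m (U m)) n V"
    by (intro mode_prod_commute) auto
  with Cons show ?case by simp
qed simp

lemma mode_prods_add: "mode_prods (X + Y) ns U = mode_prods X ns U + mode_prods Y ns U"
  by (induction ns arbitrary: X Y) (auto simp: mode_prod_add_left)

lemma mode_prods_diff: "mode_prods (X - Y) ns U = mode_prods X ns U - mode_prods Y ns U"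
  by (induction ns arbitrary: X Y) (auto simp: mode_prod_diff_left)

lemma mode_prods_zero: "mode_prods 0 ns U = 0"
  by (induction ns) (simp_all only: mode_prods_Nil mode_prods_Cons mode_prod_zero_left)

lemma mode_prods_scale: "mode_prods (\<lambda>is. t * X is) ns U = (\<lambda>is. t * mode_prods X ns U is)"
  by (induction ns arbitrary: X) (auto simp: mode_prod_scale_left)

lemma mode_prods_sum: "mode_prods (\<Sum>k\<in>K. F k) ns U = (\<Sum>k\<in>K. mode_prods (F k) ns U)"
  by (induction K rule: infinite_finite_induct)
     (simp_all only: sum.infinite sum.empty sum.insert mode_prods_zero mode_prods_add simp_thms)

text \<open>Since the modes are distinct, each outer factor can be moved inward past the other modes
  until it meets its inner partner.\<close>

lemma mode_prods_mode_prods: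
  assumes "distinct ns" "\<And>k. k \<in> set ns \<Longrightarrow> dim_col (V k) = dim_row (U k)"
  shows "mode_prods (mode_prods X ns U) ns V = mode_prods X ns (\<lambda>k. V k * U k)"
  using assms
proof (induction ns arbitrary: X)
  case (Cons n ns)
  then show ?case
    by (simp add: mode_prods_mode_prod[symmetric] mode_prod_mode_prod)
qed simp

lemma mode_prods_one:
  assumes "X \<in> tensors ds" "\<And>k. k \<in> set ns \<Longrightarrow> k < length ds \<and> U k = 1\<^sub>m (ds ! k)"
  shows "mode_prods X ns U = X"
  using assms(2) by (induction ns) (auto simp: mode_prod_one[OF assms(1)])

text \<open>Cut the list at \<open>m\<close>: the parts before and after it act as identities. The
  square \<open>V m\<close> keeps the size \<open>ds\<close>, so this also holds for the part after
  \<open>m\<close>.\<close>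

lemma mode_prods_single:
  assumes "X \<in> tensors ds" "distinct ns" "m \<in> set ns" "m < length ds"
    and "V m \<in> carrier_mat (ds ! m) (ds ! m)"
    and "\<And>k. k \<in> set ns \<Longrightarrow> k \<noteq> m \<Longrightarrow> k < length ds \<and> V k = 1\<^sub>m (ds ! k)"
  shows "mode_prods X ns V = mode_prod X m (V m)"
proof -
  obtain as bs where ns: "ns = as @ m # bs"
    using assms(3) by (auto simp: in_set_conv_decomp)
  have closed: "mode_prod X m (V m) \<in> tensors ds"
    using mode_prod_closed[OF assms(1,4,5)] by simp
  have "mode_prods X as V = X"
    by (rule mode_prods_one[OF assms(1)]) (use assms(2,6) ns in auto)
  moreover have "mode_prods (mode_prod X m (V m)) bs V = mode_prod X m (V m)"
    by (rule mode_prods_one[OF closed]) (use assms(2,6) ns in auto)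
  ultimately show ?thesis
    using ns by simp
qed

text \<open>Tracks the size of a tensor through products in the modes \<open>ns\<close>. Products
  over all modes but one lead to mixed sizes such as \<open>rs[n := Is ! n]\<close>.\<close>

definition resize :: "nat list \<Rightarrow> nat list \<Rightarrow> nat list \<Rightarrow> nat list" where
  "resize ns es ds = fold (\<lambda>n ds. ds[n := es ! n]) ns ds"

lemma resize_simps [simp]:
  "resize [] es ds = ds" "resize (n # ns) es ds = resize ns es (ds[n := es ! n])"
  by (simp_all add: resize_def)

lemma length_resize [simp]: "length (resize ns es ds) = length ds"
  by (induction ns arbitrary: ds) auto

lemma nth_resize:
  "k < length ds \<Longrightarrow> resize ns es ds ! k = (if k \<in> set ns then es ! k else ds ! k)"
  by (induction ns arbitrary: ds) (auto simp: nth_list_update)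

lemma resize_all: "length es = length ds \<Longrightarrow> resize [0..<length ds] es ds = es"
  by (rule nth_equalityI) (auto simp: nth_resize)

lemma resize_others:
  "length es = length ds \<Longrightarrow> n < length ds \<Longrightarrow>
    resize ([0..<n] @ [Suc n..<length ds]) es ds = es[n := ds ! n]"
  by (rule nth_equalityI) (auto simp: nth_resize nth_list_update)

text \<open>By distinctness a product in one mode leaves the sizes of the modes still to come as
  they are in \<open>ds\<close>, so the dimension conditions survive the induction.\<close>

lemma mode_prods_closed:
  assumes "X \<in> tensors ds" "distinct ns"
    and "\<And>k. k \<in> set ns \<Longrightarrow> k < length ds \<and> U k \<in> carrier_mat (es ! k) (ds ! k)"
  shows "mode_prods X ns U \<in> tensors (resize ns es ds)"
  using assms
proof (induction ns arbitrary: X ds)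
  case (Cons n ns)
  have "mode_prod X n (U n) \<in> tensors (ds[n := es ! n])"
    using Cons.prems by (intro mode_prod_closed) auto
  then have "mode_prods (mode_prod X n (U n)) ns U \<in> tensors (resize ns es (ds[n := es ! n]))"
    using Cons.prems(2,3) by (intro Cons.IH) (auto simp: nth_list_update)
  then show ?case by simp
qed simp

text \<open>Moving the factors across one at a time reverses their order; commutation of distinct
  modes restores it, so the same list appears on both sides.\<close>

lemma tensor_inner_adjoint_list:
  assumes "distinct ns"
    and "\<And>k. k \<in> set ns \<Longrightarrow> k < length ds \<and> U k \<in> carrier_mat (es ! k) (ds ! k)"
  shows "tensor_inner (resize ns es ds) (mode_prods X ns U) Z =
    tensor_inner ds X (mode_prods Z ns (\<lambda>k. (U k)\<^sup>T))"
  using assms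
proof (induction ns arbitrary: X ds)
  case (Cons n ns)
  have "tensor_inner (resize (n # ns) es ds) (mode_prods X (n # ns) U) Z =
      tensor_inner (ds[n := es ! n]) (mode_prod X n (U n)) (mode_prods Z ns (\<lambda>k. (U k)\<^sup>T))"
    using Cons.prems by (simp, intro Cons.IH) (auto simp: nth_list_update)
  also have "\<dots> = tensor_inner ds X (mode_prod (mode_prods Z ns (\<lambda>k. (U k)\<^sup>T)) n (U n)\<^sup>T)"
    using Cons.prems by (intro tensor_inner_adjoint) auto
  finally show ?case
    using Cons.prems(1) by (simp add: mode_prods_mode_prod)
qed simp

section \<open>Unfoldings as linear maps compatible with the inner product\<close>

lemma tensor_inner_unfolding:
  assumes "n < length ds"
  shows "tensor_inner ds X Y =
    (\<Sum>i<ds ! n. \<Sum>c<prod_list (del_mode n ds).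
       unfolding_mat ds n X $$ (i, c) * unfolding_mat ds n Y $$ (i, c))"
proof -
  have "tensor_inner ds X Y = (\<Sum>i<ds ! n. \<Sum>c<prod_list (del_mode n ds).
      X (ins_mode n i (enum_indices (del_mode n ds) c)) * Y (ins_mode n i (enum_indices (del_mode n ds) c)))"
    unfolding tensor_inner_def
    by (subst sum_multi_indices_split[OF assms], intro sum.cong[OF refl])
       (rule sum.reindex_bij_betw[OF bij_betw_enum_indices, symmetric])
  then show ?thesis by (simp add: unfolding_mat_def)
qed

lemma unfolding_mat_carrier [simp]:
  "unfolding_mat ds n X \<in> carrier_mat (ds ! n) (prod_list (del_mode n ds))"
  by (simp add: unfolding_mat_def)

lemma unfolding_mat_dim [simp]:
  "dim_row (unfolding_mat ds n X) = ds ! n"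
  "dim_col (unfolding_mat ds n X) = prod_list (del_mode n ds)"
  by (simp_all add: unfolding_mat_def)

lemma unfolding_mat_add: "unfolding_mat ds n (X + Y) = unfolding_mat ds n X + unfolding_mat ds n Y"
  by (rule eq_matI) (auto simp: unfolding_mat_def)

lemma unfolding_mat_diff: "unfolding_mat ds n (X - Y) = unfolding_mat ds n X - unfolding_mat ds n Y"
  by (rule eq_matI) (auto simp: unfolding_mat_def)

lemma unfolding_mat_zero: "unfolding_mat ds n 0 = 0\<^sub>m (ds ! n) (prod_list (del_mode n ds))"
  by (rule eq_matI) (auto simp: unfolding_mat_def)

text \<open>A zero matrix carries its dimensions, so a finite sum of matrices has to live in a
  module of fixed dimensions; this is the form of the sum in \<open>factor_eq\<close>.\<close>

lemma unfolding_mat_sum: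
  assumes "finite K"
  shows "unfolding_mat ds n (\<Sum>k\<in>K. F k) =
    (\<Oplus>\<^bsub>module_mat TYPE(real) (ds ! n) (prod_list (del_mode n ds))\<^esub>k\<in>K. unfolding_mat ds n (F k))"
proof -
  interpret M: abelian_group "module_mat TYPE(real) (ds ! n) (prod_list (del_mode n ds))"
    by (rule abelian_group_mat)
  show ?thesis
    using assms
  proof induction
    case empty
    show ?case
      by (simp only: sum.empty unfolding_mat_zero M.finsum_empty module_mat_simps)
  next
    case (insert k K)
    then show ?case
      by (subst M.finsum_insert)
         (simp_all add: unfolding_mat_add module_mat_simps Pi_def del: plus_fun_apply)
  qed
qed

section \<open>Rank and Gram matrices\<close>

text \<open>Gives access to the value behind \<open>the (mat_inverse G)\<close>: a failing inversion
  would make \<open>G\<close> a non-unit, against its nonzero determinant.\<close>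

lemma invertible_matE:
  fixes G :: "real mat"
  assumes "G \<in> carrier_mat r r" "det G \<noteq> 0"
  obtains H where "mat_inverse G = Some H" "H \<in> carrier_mat r r" "G * H = 1\<^sub>m r" "H * G = 1\<^sub>m r"
proof (cases "mat_inverse G")
  case None
  then have "G \<notin> Units (ring_mat TYPE(real) r ())"
    by (rule mat_inverse(1)[OF assms(1)])
  with det_non_zero_imp_unit[OF assms, where b = "()"] show ?thesis by blast
next
  case (Some H)
  with mat_inverse(2)[OF assms(1) Some] show ?thesis by (intro that[of H]) auto
qed

text \<open>A non-zero row annihilating \<open>W\<close> confines the columns of \<open>U * W\<close> to a proper subspace of the
  column space of \<open>U\<close>.\<close>

lemma rank_mult_annihilated:
  fixes U W P :: "real mat"
  assumes U: "U \<in> carrier_mat m r" "U\<^sup>T * U = 1\<^sub>m r"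
    and W: "W \<in> carrier_mat r N" and P: "P \<in> carrier_mat q r" "P \<noteq> 0\<^sub>m q r"
    and PW: "P * W = 0\<^sub>m q N"
  shows "vec_space.rank m (U * W) \<noteq> r"
proof
  assume rank: "vec_space.rank m (U * W) = r"
  interpret vec_space "TYPE(real)" m .
  have UW: "U * W \<in> carrier_mat m N" using U(1) W by simp
  \<comment> \<open>The rank is the size of a maximal independent set of columns, so rank
    \<open>r\<close> yields \<open>r\<close> independent columns, collected below in
    \<open>M\<close>.\<close>
  obtain S where S: "maximal S (\<lambda>T. T \<subseteq> set (cols (U * W)) \<and> lin_indpt T)"
    using maximal_exists_superset[of "set (cols (U * W))"
        "\<lambda>T. T \<subseteq> set (cols (U * W)) \<and> lin_indpt T" "{}"]
    by (auto simp: lin_dep_def)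
  then have card: "card S = r" and sub: "S \<subseteq> set (cols (U * W))" and indpt: "lin_indpt S"
    using rank_card_indpt[OF UW S] rank by (auto simp: maximal_def)
  from sub obtain xs where xs: "set xs = S" "distinct xs"
    using finite_distinct_list[OF finite_subset] by blast
  then have len: "length xs = r" using card distinct_card by metis
  have xs_carrier: "set xs \<subseteq> carrier_vec m"
    using sub xs(1) cols_dim[of "U * W"] carrier_matD(1)[OF UW] by simp
  define M where "M = mat_of_cols m xs"
  have M: "M \<in> carrier_mat m r" using mat_of_cols_carrier(1)[of m xs] by (simp add: M_def len)
  have cols_M: "cols M = xs" using xs_carrier by (simp add: M_def)
  have colM: "\<exists>c<N. col M i = U *\<^sub>v col W c" if "i < r" for i
  proof -
    have "col M i = xs ! i"
      using that M by (simp add: cols_M[symmetric])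
    then have "col M i \<in> set (cols (U * W))"
      using that len sub xs(1) nth_mem[of i xs] by auto
    then obtain c where c: "c < N" "col M i = col (U * W) c"
      using UW by (auto simp: cols_def)
    have "col (U * W) c = U *\<^sub>v col W c"
      by (rule col_mult2[OF U(1) W c(1)])
    with c show ?thesis by auto
  qed
  \<comment> \<open>The coordinates of the chosen columns with respect to \<open>U\<close>. The
    columns of this square matrix are columns of \<open>W\<close>, so \<open>P\<close> annihilates
    it too.\<close>
  define M' where "M' = U\<^sup>T * M"
  have M': "M' \<in> carrier_mat r r" using U(1) M by (simp add: M'_def)
  have colM': "\<exists>c<N. col M' i = col W c \<and> U *\<^sub>v col W c = col M i" if i: "i < r" for i
  proof -
    obtain c where c: "c < N" "col M i = U *\<^sub>v col W c" using colM[OF i] by blast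
    then have w: "col W c \<in> carrier_vec r" using W by auto
    have "col M' i = U\<^sup>T *\<^sub>v (U *\<^sub>v col W c)"
      using col_mult2[OF transpose_carrier_mat[THEN iffD2, OF U(1)] M i] c(2) by (simp add: M'_def)
    also have "\<dots> = (U\<^sup>T * U) *\<^sub>v col W c"
      by (rule assoc_mult_mat_vec[symmetric, OF transpose_carrier_mat[THEN iffD2, OF U(1)] U(1) w])
    finally have "col M' i = col W c" using U(2) w by simp
    with c show ?thesis by auto
  qed
  have "U * M' = M"
  proof (rule mat_col_eqI)
    fix i assume "i < dim_col M"
    then have i: "i < r" using M by simp
    show "col (U * M') i = col M i"
      using colM'[OF i] col_mult2[OF U(1) M' i] by auto
  qed (use U(1) M M' in auto)
  have PM': "P * M' = 0\<^sub>m q r"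
  proof (rule mat_col_eqI)
    fix i assume "i < dim_col (0\<^sub>m q r)"
    then have i: "i < r" by simp
    obtain c where c: "c < N" "col M' i = col W c" using colM'[OF i] by blast
    have "col (P * M') i = P *\<^sub>v col W c"
      using col_mult2[OF P(1) M' i] c(2) by simp
    also have "\<dots> = col (P * W) c" by (rule col_mult2[symmetric, OF P(1) W c(1)])
    also have "\<dots> = col (0\<^sub>m q r) i" using PW c i by simp
    finally show "col (P * M') i = col (0\<^sub>m q r) i" .
  qed (use P(1) M' in auto)
  \<comment> \<open>An invertible \<open>M'\<close> would cancel in \<open>P * M'\<close> and force
    \<open>P\<close> to be zero.\<close>
  have "det M' = 0"
  proof (rule ccontr)
    assume "det M' \<noteq> 0"
    then obtain H where H: "H \<in> carrier_mat r r" "M' * H = 1\<^sub>m r"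
      using invertible_matE[OF M'] by blast
    have "P = P * (M' * H)" using P(1) H by simp
    also have "\<dots> = (P * M') * H" by (rule assoc_mult_mat[symmetric, OF P(1) M' H(1)])
    also have "\<dots> = 0\<^sub>m q r" using PM' H(1) by simp
    finally show False using P(2) by simp
  qed
  then obtain x where x: "x \<in> carrier_vec r" "x \<noteq> 0\<^sub>v r" "M' *\<^sub>v x = 0\<^sub>v r"
    using det_0_iff_vec_prod_zero_field[OF M'] by blast
  \<comment> \<open>A null vector of \<open>M'\<close> is one of \<open>U * M'\<close>, which is
    \<open>M\<close>: a linear dependence among the chosen columns.\<close>
  have "M *\<^sub>v x = U *\<^sub>v (M' *\<^sub>v x)"
    using assoc_mult_mat_vec[OF U(1) M' x(1)] \<open>U * M' = M\<close> by simp
  also have "\<dots> = 0\<^sub>v m"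
    using x(3) U(1) by (intro eq_vecI) auto
  finally have "M *\<^sub>v x = 0\<^sub>v m" .
  then have "lin_dep S"
    using lin_depI[OF M x(1,2)] cols_M xs by simp
  with indpt show False by blast
qed

text \<open>The squared length of \<open>K\<^sup>T *\<^sub>v v\<close> is the scalar product of
  \<open>v\<close> with \<open>(K * K\<^sup>T) *\<^sub>v v\<close>, and a real sum of squares
  vanishes only termwise.\<close>

lemma gram_mat_kernel:
  fixes K :: "real mat"
  assumes "K \<in> carrier_mat r N" "v \<in> carrier_vec r" "(K * K\<^sup>T) *\<^sub>v v = 0\<^sub>v r"
  shows "K\<^sup>T *\<^sub>v v = 0\<^sub>v N"
proof -
  let ?w = "K\<^sup>T *\<^sub>v v"
  have w: "?w \<in> carrier_vec N" using assms by auto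
  have "?w \<bullet> ?w = v \<bullet> (K *\<^sub>v ?w)"
    by (rule transpose_vec_mult_scalar[OF assms(1) w assms(2)])
  also have "K *\<^sub>v ?w = (K * K\<^sup>T) *\<^sub>v v"
    by (rule assoc_mult_mat_vec[symmetric, OF assms(1) transpose_carrier_mat[THEN iffD2, OF assms(1)] assms(2)])
  finally have "(\<Sum>i<N. ?w $ i * ?w $ i) = 0"
    using assms(2,3) carrier_vecD[OF w] by (simp only: scalar_prod_def lessThan_atLeast0) (simp add: scalar_prod_def)
  then have "\<forall>i\<in>{..<N}. ?w $ i * ?w $ i = 0"
    by (subst (asm) sum_nonneg_eq_0_iff) auto
  then show ?thesis
    using carrier_vecD[OF w] by (intro eq_vecI) (auto simp del: index_mult_mat_vec)
qed

section \<open>Orthogonality in the space of tensors\<close>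

lemma tensors_add: "X \<in> tensors ds \<Longrightarrow> Y \<in> tensors ds \<Longrightarrow> X + Y \<in> tensors ds"
  by (simp add: tensors_def)

lemma tensors_diff: "X \<in> tensors ds \<Longrightarrow> Y \<in> tensors ds \<Longrightarrow> X - Y \<in> tensors ds"
  by (simp add: tensors_def)

lemma tensors_zero: "0 \<in> tensors ds"
  by (simp add: tensors_def)

lemma tensors_scale: "X \<in> tensors ds \<Longrightarrow> (\<lambda>is. t * X is) \<in> tensors ds"
  by (simp add: tensors_def)

lemma tensors_sum: "(\<And>k. k \<in> K \<Longrightarrow> F k \<in> tensors ds) \<Longrightarrow> (\<Sum>k\<in>K. F k) \<in> tensors ds"
  by (induction K rule: infinite_finite_induct) (simp_all add: tensors_zero tensors_add)

lemma tensor_inner_add_left: "tensor_inner ds (X + Y) Z = tensor_inner ds X Z + tensor_inner ds Y Z"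
  by (simp add: tensor_inner_def distrib_right sum.distrib)

lemma tensor_inner_zero_left: "tensor_inner ds 0 Z = 0"
  by (simp add: tensor_inner_def)

lemma tensor_inner_sum_left:
  "tensor_inner ds (\<Sum>k\<in>K. F k) Z = (\<Sum>k\<in>K. tensor_inner ds (F k) Z)"
  by (induction K rule: infinite_finite_induct)
     (simp_all only: sum.infinite sum.empty sum.insert tensor_inner_zero_left
        tensor_inner_add_left simp_thms)

lemma tensor_inner_self_nonneg: "0 \<le> tensor_inner ds X X"
  by (simp add: tensor_inner_def sum_nonneg)

lemma tensor_inner_self_eq_0:
  assumes "X \<in> tensors ds" "tensor_inner ds X X = 0"
  shows "X = 0"
proof
  fix "is"
  have "\<forall>is\<in>multi_indices ds. X is * X is = 0"
    using assms(2) by (simp add: tensor_inner_def finite_multi_indices sum_nonneg_eq_0_iff)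
  then show "X is = 0 is"
    using assms(1) by (cases "is \<in> multi_indices ds") (auto simp: tensors_def)
qed

lemma tensor_inner_expand:
  "tensor_inner ds (\<lambda>is. X is + t * Z is) (\<lambda>is. X is + t * Z is) =
    tensor_inner ds X X + 2 * t * tensor_inner ds Z X + t\<^sup>2 * tensor_inner ds Z Z"
proof -
  have "(X is + t * Z is) * (X is + t * Z is) =
      X is * X is + 2 * t * (Z is * X is) + t\<^sup>2 * (Z is * Z is)" for "is"
    by (simp add: power2_eq_square algebra_simps)
  then show ?thesis
    by (simp only: tensor_inner_def sum.distrib sum_distrib_left)
qed

text \<open>Along a line through \<open>Y\<close> in direction \<open>Z\<close> the squared distance
  is a quadratic in \<open>t\<close> with linear coefficient twice
  \<open>tensor_inner ds Z (Y - A)\<close>. A minimum at \<open>t = 0\<close> forces it to vanish;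
  the converse is Pythagoras.\<close>

lemma is_arg_min_tensor_norm_iff:
  assumes Y: "Y \<in> T"
    and lin: "\<And>X Z t. X \<in> T \<Longrightarrow> Z \<in> T \<Longrightarrow> (\<lambda>is. X is + t * Z is) \<in> T"
  shows "is_arg_min (\<lambda>Z. tensor_norm ds (Z - A)) (\<lambda>Z. Z \<in> T) Y \<longleftrightarrow>
    (\<forall>Z\<in>T. tensor_inner ds Z (Y - A) = 0)"
proof -
  let ?q = "\<lambda>X. tensor_inner ds X X"
  have shift: "?q ((\<lambda>is. Y is + t * Z is) - A) =
      ?q (Y - A) + 2 * t * tensor_inner ds Z (Y - A) + t\<^sup>2 * ?q Z" for Z t
  proof -
    have "(\<lambda>is. Y is + t * Z is) - A = (\<lambda>is. (Y - A) is + t * Z is)"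
      by (rule ext) simp
    then show ?thesis by (simp only: tensor_inner_expand)
  qed
  have "is_arg_min (\<lambda>Z. tensor_norm ds (Z - A)) (\<lambda>Z. Z \<in> T) Y \<longleftrightarrow> (\<forall>Z\<in>T. ?q (Y - A) \<le> ?q (Z - A))"
    using Y by (auto simp: is_arg_min_linorder tensor_norm_def)
  also have "\<dots> \<longleftrightarrow> (\<forall>Z\<in>T. tensor_inner ds Z (Y - A) = 0)"
  proof (intro iffI ballI)
    fix Z assume min: "\<forall>Z\<in>T. ?q (Y - A) \<le> ?q (Z - A)" and Z: "Z \<in> T"
    define a b where "a = tensor_inner ds Z (Y - A)" and "b = ?q Z"
    have b: "0 \<le> b" by (simp add: b_def tensor_inner_self_nonneg)
    have ineq: "0 \<le> 2 * t * a + t\<^sup>2 * b" for t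
      using min lin[OF Y Z, of t] shift[of t Z] unfolding a_def b_def by fastforce
    \<comment> \<open>The step length \<open>- u\<close> makes the quadratic negative unless
      \<open>u = 0\<close>. Dividing by \<open>1 + b\<close> instead of the optimal \<open>b\<close>
      covers the case \<open>b = 0\<close>.\<close>
    define u where "u = a / (1 + b)"
    have a: "a = u * (1 + b)" using b by (simp add: u_def)
    have "0 \<le> 2 * (- u) * a + (- u)\<^sup>2 * b"
      by (rule ineq)
    also have "\<dots> = - (u\<^sup>2 * (2 + b))"
      by (simp add: a power2_eq_square algebra_simps)
    finally have "u\<^sup>2 * (2 + b) \<le> 0" by simp
    moreover have "0 < 2 + b" using b by simp
    ultimately have "u\<^sup>2 \<le> 0" by (simp add: mult_le_0_iff)
    then have "u = 0" by simp
    then show "tensor_inner ds Z (Y - A) = 0" using a by (simp add: a_def)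
  next
    fix Z assume orth: "\<forall>Z\<in>T. tensor_inner ds Z (Y - A) = 0" and Z: "Z \<in> T"
    \<comment> \<open>The difference of \<open>Z\<close> and \<open>Y\<close> is itself a direction,
      so the competitor \<open>Z\<close> is reached from \<open>Y\<close> at
      \<open>t = 1\<close>.\<close>
    have mem: "(\<lambda>is. Z is + - 1 * Y is) \<in> T" by (rule lin[OF Z Y])
    have "?q ((\<lambda>is. Y is + 1 * (Z is + - 1 * Y is)) - A) =
        ?q (Y - A) + ?q (\<lambda>is. Z is + - 1 * Y is)"
      using shift[of 1 "\<lambda>is. Z is + - 1 * Y is"] orth mem by simp
    moreover have "(\<lambda>is. Y is + 1 * (Z is + - 1 * Y is)) = Z" by simp
    ultimately show "?q (Y - A) \<le> ?q (Z - A)"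
      using tensor_inner_self_nonneg[of ds "\<lambda>is. Z is + - 1 * Y is"] by simp
  qed
  finally show ?thesis .
qed

text \<open>Passing to unfoldings turns the left side into the Frobenius product of \<open>V\<close>
  times the unfolded \<open>X\<close> with the unfolded \<open>Q\<close>; moving the unfolded
  \<open>X\<close> to the other side displays it as a linear functional of \<open>V\<close> with its
  representing matrix.\<close>

lemma tensor_inner_mode_prod:
  assumes "n < length ds" "V \<in> carrier_mat m (ds ! n)"
  shows "tensor_inner (ds[n := m]) (mode_prod X n V) Q =
    (\<Sum>i<m. \<Sum>j<ds ! n. V $$ (i, j) *
       (unfolding_mat (ds[n := m]) n Q * (unfolding_mat ds n X)\<^sup>T) $$ (i, j))"
proof -
  let ?N = "prod_list (del_mode n ds)"
  let ?X = "unfolding_mat ds n X" and ?Q = "unfolding_mat (ds[n := m]) n Q"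
  have "tensor_inner (ds[n := m]) (mode_prod X n V) Q =
      (\<Sum>i<m. \<Sum>c<?N. (V * ?X) $$ (i, c) * ?Q $$ (i, c))"
    using assms
    by (subst tensor_inner_unfolding[where n = n]) (simp_all add: unfolding_mode_prod[OF assms])
  also have "\<dots> = (\<Sum>i<m. \<Sum>c<?N. \<Sum>j<ds ! n. V $$ (i, j) * (?Q $$ (i, c) * ?X $$ (j, c)))"
  proof (intro sum.cong[OF refl])
    fix i c assume "i \<in> {..<m}" "c \<in> {..<?N}"
    then have "(V * ?X) $$ (i, c) = (\<Sum>j<ds ! n. V $$ (i, j) * ?X $$ (j, c))"
      using assms by (simp add: scalar_prod_def lessThan_atLeast0)
    then show "(V * ?X) $$ (i, c) * ?Q $$ (i, c) = (\<Sum>j<ds ! n. V $$ (i, j) * (?Q $$ (i, c) * ?X $$ (j, c)))"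
      by (simp only: sum_distrib_right) (simp add: ac_simps)
  qed
  also have "\<dots> = (\<Sum>i<m. \<Sum>j<ds ! n. \<Sum>c<?N. V $$ (i, j) * (?Q $$ (i, c) * ?X $$ (j, c)))"
    by (intro sum.cong[OF refl] sum.swap)
  also have "\<dots> = (\<Sum>i<m. \<Sum>j<ds ! n. V $$ (i, j) * (?Q * ?X\<^sup>T) $$ (i, j))"
  proof (intro sum.cong[OF refl])
    fix i j assume "i \<in> {..<m}" "j \<in> {..<ds ! n}"
    then have "(?Q * ?X\<^sup>T) $$ (i, j) = (\<Sum>c<?N. ?Q $$ (i, c) * ?X $$ (j, c))"
      using assms by (simp add: scalar_prod_def lessThan_atLeast0)
    then show "(\<Sum>c<?N. V $$ (i, j) * (?Q $$ (i, c) * ?X $$ (j, c))) = V $$ (i, j) * (?Q * ?X\<^sup>T) $$ (i, j)"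
      by (simp only: sum_distrib_left)
  qed
  finally show ?thesis .
qed

text \<open>A linear functional that vanishes everywhere vanishes on its own representing matrix,
  whose squared Frobenius norm is then zero.\<close>

lemma tensor_inner_mode_prod_all_0_iff:
  assumes "n < length ds"
  shows "(\<forall>V\<in>carrier_mat m (ds ! n). tensor_inner (ds[n := m]) (mode_prod X n V) Q = 0) \<longleftrightarrow>
    unfolding_mat (ds[n := m]) n Q * (unfolding_mat ds n X)\<^sup>T = 0\<^sub>m m (ds ! n)"
    (is "?L \<longleftrightarrow> ?M = _")
proof
  have M: "?M \<in> carrier_mat m (ds ! n)"
    using assms by (intro carrier_matI) simp_all
  assume ?L
  then have "(\<Sum>i<m. \<Sum>j<ds ! n. ?M $$ (i, j) * ?M $$ (i, j)) = 0"
    using M tensor_inner_mode_prod[OF assms M, of X Q] by simp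
  then have "\<forall>i\<in>{..<m}. (\<Sum>j<ds ! n. ?M $$ (i, j) * ?M $$ (i, j)) = 0"
    by (subst (asm) sum_nonneg_eq_0_iff) (auto intro: sum_nonneg)
  then have "\<forall>i\<in>{..<m}. \<forall>j\<in>{..<ds ! n}. ?M $$ (i, j) * ?M $$ (i, j) = 0"
    by (simp only: sum_nonneg_eq_0_iff finite_lessThan zero_le_square)
  then show "?M = 0\<^sub>m m (ds ! n)"
    using M by (intro eq_matI) (auto simp del: index_mult_mat(1))
next
  assume "?M = 0\<^sub>m m (ds ! n)"
  then show ?L
    by (auto simp: tensor_inner_mode_prod[OF assms] simp del: index_mult_mat(1))
qed

lemma minus_mat_eq_zero_iff:
  fixes X Y :: "real mat"
  assumes "X \<in> carrier_mat a r" "Y \<in> carrier_mat a r"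
  shows "X - Y = 0\<^sub>m a r \<longleftrightarrow> X = Y"
proof
  assume eq: "X - Y = 0\<^sub>m a r"
  have "X $$ (i, j) = Y $$ (i, j)" if "i < a" "j < r" for i j
  proof -
    have "(X - Y) $$ (i, j) = 0" using eq that by simp
    then show ?thesis using assms that by simp
  qed
  then show "X = Y" using assms by (intro eq_matI) auto
qed (use assms in \<open>auto simp: minus_r_inv_mat\<close>)

text \<open>To be read with \<open>D\<close> as the derivative of the factor, \<open>K\<close> as
  the unfolded core, \<open>B\<close> as the unfolded projection of the given tensor,
  \<open>E\<close> and \<open>F\<close> as the contributions of the core derivative and of the other
  factors, and \<open>H\<close> as the inverse Gram matrix. The left side says that \<open>D\<close>
  times the Gram matrix is \<open>(B - E - F) * K\<^sup>T\<close>.\<close>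

lemma normal_equation_iff:
  fixes B :: "real mat"
  assumes B: "B \<in> carrier_mat a N" "E \<in> carrier_mat a N" "F \<in> carrier_mat a N"
    and D: "D \<in> carrier_mat a r" and K: "K \<in> carrier_mat r N"
    and H: "H \<in> carrier_mat r r" "K * K\<^sup>T * H = 1\<^sub>m r" "H * (K * K\<^sup>T) = 1\<^sub>m r"
  shows "(E + D * K + F - B) * K\<^sup>T = 0\<^sub>m a r \<longleftrightarrow> D = (B - E - F) * K\<^sup>T * H"
proof -
  let ?G = "K * K\<^sup>T" and ?M = "(B - E - F) * K\<^sup>T"
  have KT: "K\<^sup>T \<in> carrier_mat N r" and G: "?G \<in> carrier_mat r r" using K by auto
  have DK: "D * K \<in> carrier_mat a N" using D K by simp
  have BEF: "B - E - F \<in> carrier_mat a N" using B by auto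
  have M: "?M \<in> carrier_mat a r" using BEF KT by simp
  have DG: "D * ?G \<in> carrier_mat a r" using D G by simp
  have "E + D * K + F - B = D * K - (B - E - F)"
    using B DK by (intro eq_matI) (auto simp del: index_mult_mat(1))
  then have "(E + D * K + F - B) * K\<^sup>T = D * ?G - ?M"
    using minus_mult_distrib_mat[OF DK BEF KT] assoc_mult_mat[OF D K KT] by simp
  also have "D * ?G - ?M = 0\<^sub>m a r \<longleftrightarrow> D * ?G = ?M"
    by (rule minus_mat_eq_zero_iff[OF DG M])
  also have "\<dots> \<longleftrightarrow> D = ?M * H"
  proof
    assume "D * ?G = ?M"
    then have "?M * H = D * (?G * H)" using assoc_mult_mat[OF D G H(1)] by simp
    then show "D = ?M * H" using H(2) D by simp
  next
    assume "D = ?M * H"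
    then have "D * ?G = ?M * (H * ?G)" using assoc_mult_mat[OF M H(1) G] by simp
    then show "D * ?G = ?M" using H(3) right_mult_one_mat[OF M] by simp
  qed
  finally show ?thesis .
qed

section \<open>The tangent space and its orthogonal complement\<close>

lemma set_other_modes: "n < d \<Longrightarrow> set ([0..<n] @ [Suc n..<d]) = {..<d} - {n}"
  by auto

lemma distinct_other_modes: "distinct ([0..<n] @ [Suc n..<d])"
  by auto

text \<open>Commutation lets mode \<open>n\<close> be treated first, which exposes its factor for
  variation.\<close>

lemma all_modes_prod_split:
  assumes "n < d"
  shows "all_modes_prod d X V = other_modes_prod d n (mode_prod X n (V n)) V"
proof -
  have "[0..<d] = [0..<n] @ n # [Suc n..<d]"
    using assms by (metis upt_add_eq_append upt_conv_Cons le_add_diff_inverse less_imp_le_nat zero_le)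
  then show ?thesis
    by (simp add: all_modes_prod_def other_modes_prod_def mode_prods_mode_prod)
qed

lemma other_modes_prod_mode_prod:
  "n < d \<Longrightarrow> other_modes_prod d n (mode_prod X n W) V = mode_prod (other_modes_prod d n X V) n W"
  unfolding other_modes_prod_def by (rule mode_prods_mode_prod) auto

lemma other_modes_prod_upd [simp]: "other_modes_prod d n X (V(n := W)) = other_modes_prod d n X V"
  unfolding other_modes_prod_def by (rule mode_prods_cong) auto

lemma all_modes_prod_upd:
  "n < d \<Longrightarrow> all_modes_prod d X (V(n := W)) = other_modes_prod d n (mode_prod X n W) V"
  by (simp add: all_modes_prod_split[of n])

section \<open>Projecting back with the transposed factors\<close>

locale tucker_factors =
  fixes Is rs :: "nat list" and d :: nat and C :: tensor and U :: "nat \<Rightarrow> real mat"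
  assumes length_Is: "length Is = d" and length_rs: "length rs = d"
    and C: "C \<in> tensors rs"
    and U: "\<And>n. n < d \<Longrightarrow> U n \<in> stiefel (Is ! n) (rs ! n)"
begin

abbreviation "UT \<equiv> \<lambda>k. (U k)\<^sup>T"

lemma U_carrier: "n < d \<Longrightarrow> U n \<in> carrier_mat (Is ! n) (rs ! n)"
  and UT_U: "n < d \<Longrightarrow> (U n)\<^sup>T * U n = 1\<^sub>m (rs ! n)"
  using U by (auto simp: stiefel_def)

lemma UT_carrier: "n < d \<Longrightarrow> (U n)\<^sup>T \<in> carrier_mat (rs ! n) (Is ! n)"
  using U_carrier by simp

lemma all_modes_closed:
  assumes "X \<in> tensors rs" "\<And>n. n < d \<Longrightarrow> V n \<in> carrier_mat (Is ! n) (rs ! n)"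
  shows "all_modes_prod d X V \<in> tensors Is"
  using mode_prods_closed[OF assms(1), of "[0..<d]" V Is] assms(2) length_Is length_rs
    resize_all[of Is rs]
  by (simp add: all_modes_prod_def)

lemma all_modes_UT_closed:
  assumes "X \<in> tensors Is"
  shows "all_modes_prod d X UT \<in> tensors rs"
  using mode_prods_closed[OF assms(1), of "[0..<d]" UT rs] UT_carrier length_Is length_rs
    resize_all[of rs Is]
  by (simp add: all_modes_prod_def)

lemma other_modes_UT_other_modes:
  assumes "n < d" and V: "\<And>k. k < d \<Longrightarrow> k \<noteq> n \<Longrightarrow> V k \<in> carrier_mat (Is ! k) (rs ! k)"
  shows "other_modes_prod d n (other_modes_prod d n X V) UT =
    other_modes_prod d n X (\<lambda>k. (U k)\<^sup>T * V k)"
  unfolding other_modes_prod_def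
proof (rule mode_prods_mode_prods[OF distinct_other_modes])
  fix k assume "k \<in> set ([0..<n] @ [Suc n..<d])"
  then have k: "k < d" "k \<noteq> n" unfolding set_other_modes[OF assms(1)] by auto
  show "dim_col ((U k)\<^sup>T) = dim_row (V k)"
    using carrier_matD(1)[OF V[OF k]] carrier_matD(1)[OF U_carrier[OF k(1)]] by simp
qed

text \<open>In every mode other than \<open>n\<close> the transposed factor cancels against
  \<open>U k\<close>, so only the varied factor remains.\<close>

lemma other_modes_UT_upd:
  assumes "n < d" "X \<in> tensors rs" "W \<in> carrier_mat (Is ! n) (rs ! n)"
  shows "other_modes_prod d n (all_modes_prod d X (U(n := W))) UT = mode_prod X n W"
proof -
  have closed: "mode_prod X n W \<in> tensors (rs[n := Is ! n])"
    using assms length_rs by (intro mode_prod_closed) auto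
  have "other_modes_prod d n (all_modes_prod d X (U(n := W))) UT =
      other_modes_prod d n (mode_prod X n W) (\<lambda>k. (U k)\<^sup>T * U k)"
    using assms(1) U_carrier by (simp add: all_modes_prod_upd other_modes_UT_other_modes)
  also have "\<dots> = mode_prod X n W"
    unfolding other_modes_prod_def
    by (rule mode_prods_one[OF closed])
       (unfold set_other_modes[OF assms(1)], use length_rs UT_U in auto)
  finally show ?thesis .
qed

lemma other_modes_UT_all_modes:
  assumes "n < d" "X \<in> tensors rs"
  shows "other_modes_prod d n (all_modes_prod d X U) UT = mode_prod X n (U n)"
  using other_modes_UT_upd[OF assms U_carrier[OF assms(1)]] by simp

text \<open>Here the varied mode \<open>k\<close> is projected, leaving
  \<open>(U k)\<^sup>T * W\<close>, while mode \<open>n\<close> is not, so \<open>U n\<close>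
  stays.\<close>

lemma other_modes_UT_upd_other:
  assumes "n < d" "k < d" "k \<noteq> n" "X \<in> tensors rs" "W \<in> carrier_mat (Is ! k) (rs ! k)"
  shows "other_modes_prod d n (all_modes_prod d X (U(k := W))) UT =
    mode_prod (mode_prod X k ((U k)\<^sup>T * W)) n (U n)"
proof -
  have Un: "mode_prod X n (U n) \<in> tensors (rs[n := Is ! n])"
    using assms length_rs U_carrier by (intro mode_prod_closed) auto
  have "other_modes_prod d n (all_modes_prod d X (U(k := W))) UT =
      other_modes_prod d n (mode_prod X n (U n)) (\<lambda>j. (U j)\<^sup>T * (U(k := W)) j)"
    using assms U_carrier
    by (simp add: all_modes_prod_split[OF assms(1)] other_modes_UT_other_modes)
  also have "\<dots> = mode_prod (mode_prod X n (U n)) k ((U k)\<^sup>T * (U(k := W)) k)"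
    unfolding other_modes_prod_def
  proof (rule mode_prods_single[OF Un distinct_other_modes])
    show "(U k)\<^sup>T * (U(k := W)) k \<in> carrier_mat (rs[n := Is ! n] ! k) (rs[n := Is ! n] ! k)"
      using mult_carrier_mat[OF UT_carrier[OF assms(2)] assms(5)] assms(3) by simp
  next
    fix j assume "j \<in> set ([0..<n] @ [Suc n..<d])" and "j \<noteq> k"
    then have "j < d" "j \<noteq> n" "j \<noteq> k" unfolding set_other_modes[OF assms(1)] by auto
    then show "j < length (rs[n := Is ! n]) \<and> (U j)\<^sup>T * (U(k := W)) j = 1\<^sub>m (rs[n := Is ! n] ! j)"
      using UT_U[of j] length_rs by simp
  qed (use assms length_rs in auto)
  finally show ?thesis
    using assms(3) by (simp add: mode_prod_commute[of n k])
qed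

lemma all_modes_UT_split:
  "n < d \<Longrightarrow> all_modes_prod d X UT = mode_prod (other_modes_prod d n X UT) n ((U n)\<^sup>T)"
  by (simp add: all_modes_prod_split[of n] other_modes_prod_mode_prod)

lemma all_modes_UT_upd:
  assumes "n < d" "X \<in> tensors rs" "W \<in> carrier_mat (Is ! n) (rs ! n)"
  shows "all_modes_prod d (all_modes_prod d X (U(n := W))) UT = mode_prod X n ((U n)\<^sup>T * W)"
  using assms U_carrier[OF assms(1)]
  by (simp add: all_modes_UT_split[OF assms(1)] other_modes_UT_upd[OF assms] mode_prod_mode_prod)

text \<open>The case of replacing the factor in mode 0 by itself; \<open>0 < d\<close> supplies that
  mode.\<close>

lemma all_modes_UT_all_modes:
  assumes "0 < d" "X \<in> tensors rs"
  shows "all_modes_prod d (all_modes_prod d X U) UT = X"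
  using all_modes_UT_upd[OF assms U_carrier[OF assms(1)]] mode_prod_one[OF assms(2)] assms(1)
    UT_U length_rs
  by simp

lemma tensor_inner_all_modes:
  "tensor_inner Is (all_modes_prod d X U) R = tensor_inner rs X (all_modes_prod d R UT)"
  using tensor_inner_adjoint_list[of "[0..<d]" rs U Is X R] U_carrier length_Is length_rs
    resize_all[of Is rs]
  by (simp add: all_modes_prod_def)

text \<open>Only the factors of the other modes are moved across. Keeping mode \<open>n\<close> on
  the left leaves an expression linear in \<open>W\<close>, as needed to test with all
  \<open>W\<close>.\<close>

lemma tensor_inner_upd:
  assumes "n < d"
  shows "tensor_inner Is (all_modes_prod d X (U(n := W))) R =
    tensor_inner (rs[n := Is ! n]) (mode_prod X n W) (other_modes_prod d n R UT)"
proof -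
  have "tensor_inner (resize ([0..<n] @ [Suc n..<d]) Is (rs[n := Is ! n]))
      (mode_prods (mode_prod X n W) ([0..<n] @ [Suc n..<d]) U) R =
      tensor_inner (rs[n := Is ! n]) (mode_prod X n W) (mode_prods R ([0..<n] @ [Suc n..<d]) UT)"
    by (rule tensor_inner_adjoint_list[OF distinct_other_modes])
       (unfold set_other_modes[OF assms], use U_carrier length_rs in auto)
  moreover have "resize ([0..<n] @ [Suc n..<d]) Is (rs[n := Is ! n]) = Is"
    using resize_others[of Is "rs[n := Is ! n]" n] assms length_Is length_rs by simp
  ultimately show ?thesis
    by (simp only: all_modes_prod_upd[OF assms] other_modes_prod_def)
qed

text \<open>The redundancy of the parametrization: a factor variation inside the column space of
  \<open>U n\<close> can be absorbed into the core.\<close>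

lemma all_modes_upd_core:
  assumes "n < d" "S \<in> carrier_mat (rs ! n) (rs ! n)"
  shows "all_modes_prod d X (U(n := U n * S)) = all_modes_prod d (mode_prod X n S) U"
  using assms U_carrier[OF assms(1)]
  by (simp add: all_modes_prod_upd all_modes_prod_split[of n d "mode_prod X n S"] mode_prod_mode_prod)

lemma all_modes_upd_add:
  assumes "n < d" "V \<in> carrier_mat (Is ! n) (rs ! n)" "W \<in> carrier_mat (Is ! n) (rs ! n)"
  shows "all_modes_prod d X (U(n := V + W)) =
    all_modes_prod d X (U(n := V)) + all_modes_prod d X (U(n := W))"
  using assms(1)
  by (simp only: all_modes_prod_upd mode_prod_add_right[OF assms(2,3)] other_modes_prod_def mode_prods_add)

lemma all_modes_upd_smult:
  assumes "n < d"
  shows "all_modes_prod d X (U(n := t \<cdot>\<^sub>m V)) = (\<lambda>is. t * all_modes_prod d X (U(n := V)) is)"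
  using assms
  by (simp only: all_modes_prod_upd mode_prod_smult_right other_modes_prod_def mode_prods_scale)

lemma all_modes_upd_zero:
  assumes "n < d"
  shows "all_modes_prod d X (U(n := 0\<^sub>m a b)) = 0"
  using assms
  by (simp only: all_modes_prod_upd mode_prod_zero_right other_modes_prod_def mode_prods_zero)

section \<open>Tangent tensors: their projections and their linear structure\<close>

abbreviation "tangent \<equiv> tangent_tensor d C U"
abbreviation "tangent_dirs \<equiv> {dU. \<forall>n<d. dU n \<in> stiefel_tangent (Is ! n) (rs ! n) (U n)}"

lemma tangent_space_eq:
  "tucker_tangent_space Is rs C U = {tangent dC dU | dC dU. dC \<in> tensors rs \<and> dU \<in> tangent_dirs}"
  by (simp add: tucker_tangent_space_def length_Is)

lemma tangent_memI: "dC \<in> tensors rs \<Longrightarrow> dU \<in> tangent_dirs \<Longrightarrow> tangent dC dU \<in> tucker_tangent_space Is rs C U"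
  unfolding tangent_space_eq by blast

lemma tangent_dirs_carrier: "dU \<in> tangent_dirs \<Longrightarrow> n < d \<Longrightarrow> dU n \<in> carrier_mat (Is ! n) (rs ! n)"
  by (auto simp: stiefel_tangent_def)

lemma all_modes_UT_tangent:
  assumes "0 < d" "dC \<in> tensors rs" "dU \<in> tangent_dirs"
  shows "all_modes_prod d (tangent dC dU) UT = dC + (\<Sum>k<d. mode_prod C k ((U k)\<^sup>T * dU k))"
proof -
  have "all_modes_prod d (tangent dC dU) UT = all_modes_prod d (all_modes_prod d dC U) UT +
      (\<Sum>k<d. all_modes_prod d (all_modes_prod d C (U(k := dU k))) UT)"
    by (simp only: tangent_tensor_def all_modes_prod_def mode_prods_add mode_prods_sum)
  also have "(\<Sum>k<d. all_modes_prod d (all_modes_prod d C (U(k := dU k))) UT) =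
      (\<Sum>k<d. mode_prod C k ((U k)\<^sup>T * dU k))"
    using all_modes_UT_upd[OF _ C] tangent_dirs_carrier[OF assms(3)] by (intro sum.cong) auto
  finally show ?thesis by (simp only: all_modes_UT_all_modes[OF assms(1,2)])
qed

text \<open>The summands separate into the core part, the part of mode \<open>n\<close>, where
  \<open>dU n\<close> appears unprojected, and the parts of the other modes, which enter only
  through \<open>(U k)\<^sup>T * dU k\<close>.\<close>

lemma other_modes_UT_tangent:
  assumes "n < d" "dC \<in> tensors rs" "dU \<in> tangent_dirs"
  shows "other_modes_prod d n (tangent dC dU) UT = mode_prod dC n (U n) + mode_prod C n (dU n) +
    mode_prod (\<Sum>k\<in>{..<d} - {n}. mode_prod C k ((U k)\<^sup>T * dU k)) n (U n)"
proof -
  let ?f = "\<lambda>k. other_modes_prod d n (all_modes_prod d C (U(k := dU k))) UT"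
  have "other_modes_prod d n (tangent dC dU) UT =
      other_modes_prod d n (all_modes_prod d dC U) UT + (\<Sum>k<d. ?f k)"
    by (simp only: tangent_tensor_def other_modes_prod_def mode_prods_add mode_prods_sum)
  also have "(\<Sum>k<d. ?f k) = ?f n + (\<Sum>k\<in>{..<d} - {n}. ?f k)"
    using assms(1) by (intro sum.remove) auto
  also have "(\<Sum>k\<in>{..<d} - {n}. ?f k) =
      (\<Sum>k\<in>{..<d} - {n}. mode_prod (mode_prod C k ((U k)\<^sup>T * dU k)) n (U n))"
    using other_modes_UT_upd_other[OF assms(1) _ _ C] tangent_dirs_carrier[OF assms(3)]
    by (intro sum.cong) auto
  finally show ?thesis
    by (simp only: other_modes_UT_all_modes[OF assms(1,2)] mode_prod_sum_left
        other_modes_UT_upd[OF assms(1) C tangent_dirs_carrier[OF assms(3,1)]] add.assoc)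
qed

lemma tangent_dirs_linear:
  assumes "dU \<in> tangent_dirs" "dV \<in> tangent_dirs"
  shows "(\<lambda>n. dU n + t \<cdot>\<^sub>m dV n) \<in> tangent_dirs"
proof (intro CollectI allI impI)
  fix n assume n: "n < d"
  let ?r = "rs ! n"
  let ?A = "(dU n)\<^sup>T * U n" and ?B = "(U n)\<^sup>T * dU n" and ?A' = "(dV n)\<^sup>T * U n" and ?B' = "(U n)\<^sup>T * dV n"
  note Un = U_carrier[OF n] and UTn = UT_carrier[OF n]
  have dU: "dU n \<in> carrier_mat (Is ! n) ?r" "?A + ?B = 0\<^sub>m ?r ?r"
    and dV: "dV n \<in> carrier_mat (Is ! n) ?r" "?A' + ?B' = 0\<^sub>m ?r ?r"
    using assms n by (auto simp: stiefel_tangent_def)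
  have 1: "(dU n + t \<cdot>\<^sub>m dV n)\<^sup>T * U n = ?A + t \<cdot>\<^sub>m ?A'"
  proof -
    have "(dU n + t \<cdot>\<^sub>m dV n)\<^sup>T = (dU n)\<^sup>T + t \<cdot>\<^sub>m (dV n)\<^sup>T"
      using dU(1) dV(1) by (intro eq_matI) auto
    then show ?thesis
      using dU(1) dV(1) Un
      by (simp add: add_mult_distrib_mat[of _ ?r "Is ! n"] mult_smult_assoc_mat[of _ ?r "Is ! n"])
  qed
  have 2: "(U n)\<^sup>T * (dU n + t \<cdot>\<^sub>m dV n) = ?B + t \<cdot>\<^sub>m ?B'"
    using dU(1) dV(1) UTn
    by (simp add: mult_add_distrib_mat[of _ ?r "Is ! n"] mult_smult_distrib[of _ ?r "Is ! n"])
  have carr: "?A \<in> carrier_mat ?r ?r" "?B \<in> carrier_mat ?r ?r" "?A' \<in> carrier_mat ?r ?r" "?B' \<in> carrier_mat ?r ?r"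
    using dU(1) dV(1) Un by auto
  \<comment> \<open>Regrouping is proved for arbitrary matrices, so that the entrywise comparison
    does not open the products.\<close>
  have "(A + t \<cdot>\<^sub>m A') + (B + t \<cdot>\<^sub>m B') = (A + B) + t \<cdot>\<^sub>m (A' + B')"
    if "A \<in> carrier_mat ?r ?r" "B \<in> carrier_mat ?r ?r" "A' \<in> carrier_mat ?r ?r" "B' \<in> carrier_mat ?r ?r"
    for A B A' B' :: "real mat"
    using that by (intro eq_matI) (auto simp: distrib_left)
  from this[OF carr] have "(?A + t \<cdot>\<^sub>m ?A') + (?B + t \<cdot>\<^sub>m ?B') = (?A + ?B) + t \<cdot>\<^sub>m (?A' + ?B')" .
  also have "\<dots> = 0\<^sub>m ?r ?r"
    unfolding dU(2) dV(2) by (intro eq_matI) auto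
  finally show "dU n + t \<cdot>\<^sub>m dV n \<in> stiefel_tangent (Is ! n) ?r (U n)"
    using dU(1) dV(1) 1 2 by (simp add: stiefel_tangent_def)
qed

text \<open>With \<open>C\<close> and \<open>U\<close> fixed, the tangent tensor depends linearly on
  \<open>dC\<close> and \<open>dU\<close> jointly, and the skew-symmetry constraint is linear
  too.\<close>

lemma tangent_space_linear:
  assumes "X \<in> tucker_tangent_space Is rs C U" "Z \<in> tucker_tangent_space Is rs C U"
  shows "(\<lambda>is. X is + t * Z is) \<in> tucker_tangent_space Is rs C U"
proof -
  obtain dC dU dD dV where X: "X = tangent dC dU" "dC \<in> tensors rs" "dU \<in> tangent_dirs"
    and Z: "Z = tangent dD dV" "dD \<in> tensors rs" "dV \<in> tangent_dirs"
    using assms unfolding tangent_space_eq by blast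
  have "tangent (dC + (\<lambda>is. t * dD is)) (\<lambda>n. dU n + t \<cdot>\<^sub>m dV n) is = X is + t * Z is" for "is"
  proof -
    have core: "all_modes_prod d (dC + (\<lambda>is. t * dD is)) U is =
        all_modes_prod d dC U is + t * all_modes_prod d dD U is"
      by (simp only: all_modes_prod_def mode_prods_add mode_prods_scale plus_fun_apply)
    have upd: "all_modes_prod d C (U(n := dU n + t \<cdot>\<^sub>m dV n)) is =
        all_modes_prod d C (U(n := dU n)) is + t * all_modes_prod d C (U(n := dV n)) is" if "n < d" for n
      using tangent_dirs_carrier[OF X(3) that] tangent_dirs_carrier[OF Z(3) that] that
      by (simp only: all_modes_upd_add[OF that] smult_carrier_mat all_modes_upd_smult plus_fun_apply)
    have "(\<Sum>n<d. all_modes_prod d C (U(n := dU n + t \<cdot>\<^sub>m dV n)) is) =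
        (\<Sum>n<d. all_modes_prod d C (U(n := dU n)) is) + t * (\<Sum>n<d. all_modes_prod d C (U(n := dV n)) is)"
      unfolding sum_distrib_left sum.distrib[symmetric] by (rule sum.cong[OF refl]) (simp only: upd lessThan_iff)
    with core show ?thesis
      by (simp only: X(1) Z(1) tangent_tensor_def plus_fun_apply sum_apply distrib_left add.assoc add.left_commute)
  qed
  then have "(\<lambda>is. X is + t * Z is) = tangent (dC + (\<lambda>is. t * dD is)) (\<lambda>n. dU n + t \<cdot>\<^sub>m dV n)"
    by (intro ext) (rule sym)
  with tangent_memI[OF tensors_add[OF X(2) tensors_scale[OF Z(2)]] tangent_dirs_linear[OF X(3) Z(3)]]
  show ?thesis by (simp only:)
qed

lemma zero_dirs: "(\<lambda>n. 0\<^sub>m (Is ! n) (rs ! n)) \<in> tangent_dirs"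
proof (intro CollectI allI impI)
  fix n assume "n < d"
  then show "0\<^sub>m (Is ! n) (rs ! n) \<in> stiefel_tangent (Is ! n) (rs ! n) (U n)"
    using left_mult_zero_mat[OF U_carrier] right_mult_zero_mat[OF UT_carrier]
    by (simp add: stiefel_tangent_def)
qed

lemma core_direction:
  assumes "D \<in> tensors rs"
  shows "all_modes_prod d D U \<in> tucker_tangent_space Is rs C U"
proof -
  have "(\<Sum>n<d. all_modes_prod d C (U(n := 0\<^sub>m (Is ! n) (rs ! n)))) = 0"
    by (intro sum.neutral ballI all_modes_upd_zero) simp
  then have "tangent D (\<lambda>n. 0\<^sub>m (Is ! n) (rs ! n)) = all_modes_prod d D U"
    by (simp only: tangent_tensor_def add_0_right)
  with tangent_memI[OF assms zero_dirs] show ?thesis by (simp only:)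
qed

text \<open>For such \<open>W\<close> both terms of the constraint vanish separately, one being the
  transpose of the other. Zero derivatives everywhere else isolate the single summand.\<close>

lemma factor_direction:
  assumes "n < d" "W \<in> carrier_mat (Is ! n) (rs ! n)" "(U n)\<^sup>T * W = 0\<^sub>m (rs ! n) (rs ! n)"
  shows "all_modes_prod d C (U(n := W)) \<in> tucker_tangent_space Is rs C U"
proof -
  let ?V = "\<lambda>k. if k = n then W else 0\<^sub>m (Is ! k) (rs ! k)"
  have "W\<^sup>T * U n = ((U n)\<^sup>T * W)\<^sup>T"
    using transpose_mult[OF UT_carrier[OF assms(1)] assms(2)] by simp
  then have "W\<^sup>T * U n = 0\<^sub>m (rs ! n) (rs ! n)"
    using assms(3) by simp
  then have V: "?V \<in> tangent_dirs"
    using zero_dirs assms by (auto simp: stiefel_tangent_def)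
  have "(\<Sum>k<d. all_modes_prod d C (U(k := ?V k))) =
      all_modes_prod d C (U(n := ?V n)) + (\<Sum>k\<in>{..<d} - {n}. all_modes_prod d C (U(k := ?V k)))"
    using assms(1) by (intro sum.remove) auto
  also have "(\<Sum>k\<in>{..<d} - {n}. all_modes_prod d C (U(k := ?V k))) = 0"
  proof (intro sum.neutral ballI)
    fix k assume "k \<in> {..<d} - {n}"
    then show "all_modes_prod d C (U(k := ?V k)) = 0"
      using all_modes_upd_zero[of k] by simp
  qed
  finally have "tangent 0 ?V = all_modes_prod d C (U(n := W))"
    by (simp only: tangent_tensor_def all_modes_prod_def mode_prods_zero add_0_right add_0_left if_True simp_thms)
  with tangent_memI[OF tensors_zero V] show ?thesis by (simp only:)
qed

text \<open>A direction \<open>V\<close> in mode \<open>n\<close> splits as \<open>U n * S + W\<close> with \<open>S = (U n)\<^sup>T * V\<close> and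
  \<open>(U n)\<^sup>T * W = 0\<close>; the first part only moves the core, so the skew-symmetry constraint does not
  restrict the set of test directions.\<close>

lemma tangent_space_orthogonal_iff:
  assumes "R \<in> tensors Is"
  shows "(\<forall>Z\<in>tucker_tangent_space Is rs C U. tensor_inner Is Z R = 0) \<longleftrightarrow>
    all_modes_prod d R UT = 0 \<and>
    (\<forall>n<d. unfolding_mat (rs[n := Is ! n]) n (other_modes_prod d n R UT) * (unfolding_mat rs n C)\<^sup>T
       = 0\<^sub>m (Is ! n) (rs ! n))"
proof -
  have "(\<forall>Z\<in>tucker_tangent_space Is rs C U. tensor_inner Is Z R = 0) \<longleftrightarrow>
    all_modes_prod d R UT = 0 \<and>
    (\<forall>n<d. \<forall>V\<in>carrier_mat (Is ! n) (rs ! n). tensor_inner Is (all_modes_prod d C (U(n := V))) R = 0)"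
    (is "?L \<longleftrightarrow> ?M \<and> ?R")
  proof
    assume L: ?L
    \<comment> \<open>The projected residual is itself taken as the core variation, so its squared
      norm is zero.\<close>
    have "tensor_inner rs (all_modes_prod d R UT) (all_modes_prod d R UT) = 0"
      using L core_direction[OF all_modes_UT_closed[OF assms]]
      by (simp add: tensor_inner_all_modes[symmetric])
    then have M: ?M
      by (rule tensor_inner_self_eq_0[OF all_modes_UT_closed[OF assms]])
    moreover have ?R
    proof (intro allI impI ballI)
      fix n and V :: "real mat" assume n: "n < d" and V: "V \<in> carrier_mat (Is ! n) (rs ! n)"
      define S where "S = (U n)\<^sup>T * V"
      define W where "W = V - U n * S"
      note Un = U_carrier[OF n] and UTn = UT_carrier[OF n]
      have S: "S \<in> carrier_mat (rs ! n) (rs ! n)" using UTn V by (simp add: S_def)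
      have US: "U n * S \<in> carrier_mat (Is ! n) (rs ! n)" using Un S by simp
      have W: "W \<in> carrier_mat (Is ! n) (rs ! n)" using US V by (simp add: W_def minus_carrier_mat)
      have "(U n)\<^sup>T * W = S - ((U n)\<^sup>T * U n) * S"
        using mult_minus_distrib_mat[OF UTn V US] assoc_mult_mat[OF UTn Un S] by (simp add: W_def S_def)
      also have "\<dots> = 0\<^sub>m (rs ! n) (rs ! n)"
        using S by (simp add: UT_U[OF n] minus_r_inv_mat)
      finally have "all_modes_prod d C (U(n := W)) \<in> tucker_tangent_space Is rs C U"
        by (rule factor_direction[OF n W])
      then have "tensor_inner Is (all_modes_prod d C (U(n := W))) R = 0" using L by blast
      \<comment> \<open>By adjointness this pairs a changed core with the projected residual,
        already known to be zero.\<close>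
      moreover have "tensor_inner Is (all_modes_prod d C (U(n := U n * S))) R = 0"
        by (simp only: all_modes_upd_core[OF n S] tensor_inner_all_modes M)
           (simp add: tensor_inner_def)
      moreover have "V = (V - Y) + Y" if "Y \<in> carrier_mat (Is ! n) (rs ! n)" for Y :: "real mat"
        using V that by (intro eq_matI) auto
      from this[OF US] have "V = W + U n * S" by (simp only: W_def)
      ultimately show "tensor_inner Is (all_modes_prod d C (U(n := V))) R = 0"
        using all_modes_upd_add[OF n W US, of C] by (simp only: tensor_inner_add_left add_0_right)
    qed
    ultimately show "?M \<and> ?R" ..
  next
    assume MR: "?M \<and> ?R"
    show ?L
    proof
      fix Z assume "Z \<in> tucker_tangent_space Is rs C U"
      then obtain dC dU where Z: "Z = tangent dC dU" "dC \<in> tensors rs" "dU \<in> tangent_dirs"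
        unfolding tangent_space_eq by blast
      have "tensor_inner Is (all_modes_prod d dC U) R = 0"
        using MR by (simp only: tensor_inner_all_modes) (simp add: tensor_inner_def)
      moreover have "(\<Sum>n<d. tensor_inner Is (all_modes_prod d C (U(n := dU n))) R) = 0"
        using MR tangent_dirs_carrier[OF Z(3)] by (intro sum.neutral) auto
      ultimately show "tensor_inner Is Z R = 0"
        by (simp only: Z(1) tangent_tensor_def tensor_inner_add_left tensor_inner_sum_left add_0_right)
    qed
  qed
  \<comment> \<open>With \<open>V\<close> now unconstrained, the vanishing of a linear functional
    becomes a matrix equation in each mode.\<close>
  moreover have "(\<forall>V\<in>carrier_mat (Is ! n) (rs ! n). tensor_inner Is (all_modes_prod d C (U(n := V))) R = 0) \<longleftrightarrow>
      unfolding_mat (rs[n := Is ! n]) n (other_modes_prod d n R UT) * (unfolding_mat rs n C)\<^sup>T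
       = 0\<^sub>m (Is ! n) (rs ! n)" if "n < d" for n
    using tensor_inner_mode_prod_all_0_iff[of n rs "Is ! n" C] that length_rs
    by (simp only: tensor_inner_upd)
  ultimately show ?thesis by auto
qed

section \<open>Invertibility of the Gram matrix of the unfolded core\<close>

lemma unfolding_all_modes:
  assumes "n < d"
  shows "unfolding_mat Is n (all_modes_prod d X U) =
    U n * unfolding_mat (Is[n := rs ! n]) n (other_modes_prod d n X U)"
  using unfolding_mode_prod[of n "Is[n := rs ! n]" "U n" "Is ! n"] assms length_Is U_carrier
  by (simp add: all_modes_prod_split[OF assms] other_modes_prod_mode_prod)

text \<open>A left null vector of the unfolded core is a left null vector of the coefficients of
  \<open>all_modes_prod d C U\<close> in the basis \<open>U n\<close>, hence lowers the rank in mode \<open>n\<close>.\<close>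

lemma core_gram_det:
  assumes n: "n < d"
    and rank: "vec_space.rank (Is ! n) (unfolding_mat Is n (all_modes_prod d C U)) = rs ! n"
  shows "det (unfolding_mat rs n C * (unfolding_mat rs n C)\<^sup>T) \<noteq> 0"
proof
  let ?r = "rs ! n" and ?N = "prod_list (del_mode n rs)"
  let ?K = "unfolding_mat rs n C"
  let ?W = "unfolding_mat (Is[n := ?r]) n (other_modes_prod d n C U)"
  have K: "?K \<in> carrier_mat ?r ?N" by (rule unfolding_mat_carrier)
  have KK: "?K * ?K\<^sup>T \<in> carrier_mat ?r ?r" by (intro carrier_matI) simp_all
  assume "det (?K * ?K\<^sup>T) = 0"
  then obtain v where v: "v \<in> carrier_vec ?r" "v \<noteq> 0\<^sub>v ?r" "(?K * ?K\<^sup>T) *\<^sub>v v = 0\<^sub>v ?r"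
    using det_0_iff_vec_prod_zero_field[OF KK] by blast
  have ker: "?K\<^sup>T *\<^sub>v v = 0\<^sub>v ?N" by (rule gram_mat_kernel[OF K v(1,3)])
  \<comment> \<open>The null vector is written as a matrix with one row, so that it can act by a
    mode product that shrinks mode \<open>n\<close> to size 1.\<close>
  define P where "P = mat 1 ?r (\<lambda>(i, j). v $ j)"
  have P: "P \<in> carrier_mat 1 ?r" by (simp add: P_def)
  have "P \<noteq> 0\<^sub>m 1 ?r"
  proof
    assume "P = 0\<^sub>m 1 ?r"
    then have "P $$ (0, j) = 0" if "j < ?r" for j using that by simp
    then have "v = 0\<^sub>v ?r" using v(1) by (intro eq_vecI) (auto simp: P_def)
    with v(2) show False ..
  qed
  have PK: "P * ?K = 0\<^sub>m 1 ?N"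
  proof (rule eq_matI)
    fix i c assume "i < dim_row (0\<^sub>m 1 ?N)" "c < dim_col (0\<^sub>m 1 ?N)"
    then have i: "i = 0" and c: "c < ?N" by auto
    have "row P 0 = v" using v(1) by (intro eq_vecI) (auto simp: P_def)
    then have "(P * ?K) $$ (0, c) = v \<bullet> col ?K c" using c P by simp
    also have "\<dots> = col ?K c \<bullet> v" using v(1) K c by (intro comm_scalar_prod) auto
    also have "\<dots> = (?K\<^sup>T *\<^sub>v v) $ c" using c by simp
    finally show "(P * ?K) $$ (i, c) = 0\<^sub>m 1 ?N $$ (i, c)" using ker c i by simp
  qed (use P in auto)
  have n': "n < length rs" "n < length (rs[n := 1])" "n < length (Is[n := ?r])"
    using n length_rs length_Is by simp_all
  \<comment> \<open>Folding back to tensors carries the annihilation from the core to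
    \<open>?W\<close>: a zero tensor stays zero under the products in the other modes, and these
    commute with \<open>P\<close>. No formula for the unfolding of a multiple product is
    required.\<close>
  have "mode_prod C n P = 0"
  proof (rule unfolding_mat_inject[OF n'(2)])
    show "mode_prod C n P \<in> tensors (rs[n := 1])" by (rule mode_prod_closed[OF C n'(1) P])
    show "unfolding_mat (rs[n := 1]) n (mode_prod C n P) = unfolding_mat (rs[n := 1]) n 0"
      using n'(1) by (simp only: unfolding_mode_prod[OF n'(1) P] PK unfolding_mat_zero) simp
  qed (rule tensors_zero)
  then have "mode_prod (other_modes_prod d n C U) n P = 0"
    using other_modes_prod_mode_prod[OF n, of C P U] by (simp only: other_modes_prod_def mode_prods_zero)
  moreover have "P * ?W = unfolding_mat ((Is[n := ?r])[n := 1]) n (mode_prod (other_modes_prod d n C U) n P)"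
    using unfolding_mode_prod[OF n'(3), of P 1] P n'(3) by simp
  ultimately have PW: "P * ?W = 0\<^sub>m 1 (prod_list (del_mode n Is))"
    using n'(3) by (simp only: unfolding_mat_zero) simp
  have W: "?W \<in> carrier_mat ?r (prod_list (del_mode n Is))"
    using n'(3) by (intro carrier_matI) simp_all
  show False
    using rank_mult_annihilated[OF U_carrier[OF n] UT_U[OF n] W P \<open>P \<noteq> 0\<^sub>m 1 ?r\<close> PW] rank
    by (simp add: unfolding_all_modes[OF n])
qed

section \<open>From orthogonality to the core and factor equations\<close>

lemma core_eq_iff:
  assumes "0 < d" "dC \<in> tensors rs" "dU \<in> tangent_dirs"
  shows "all_modes_prod d (tangent dC dU - A) UT = 0 \<longleftrightarrow> core_eq d C U A dC dU"
proof -
  have eq: "all_modes_prod d (tangent dC dU - A) UT =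
      dC + (\<Sum>k<d. mode_prod C k ((U k)\<^sup>T * dU k)) - all_modes_prod d A UT"
    unfolding all_modes_UT_tangent[OF assms, symmetric]
    by (simp only: all_modes_prod_def mode_prods_diff)
  show ?thesis
    unfolding eq core_eq_def eq_diff_eq by (rule right_minus_eq)
qed

lemma factor_sum_unfolding:
  "(\<Oplus>\<^bsub>module_mat TYPE(real) (rs ! n) (prod_list (del_mode n rs))\<^esub>
      k\<in>{..<d} - {n}. unfolding_mat rs n (mode_prod C k ((U k)\<^sup>T * dU k))) =
    unfolding_mat rs n (\<Sum>k\<in>{..<d} - {n}. mode_prod C k ((U k)\<^sup>T * dU k))"
  by (rule unfolding_mat_sum[symmetric]) simp

text \<open>After projection along the other modes, \<open>dU n\<close> occurs only as a left factor
  of the unfolded core, so orthogonality is a linear equation for it, solvable because the rank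
  makes the Gram matrix invertible.\<close>

lemma factor_eq_iff:
  assumes n: "n < d" and "dC \<in> tensors rs" and dU: "dU \<in> tangent_dirs"
    and rank: "vec_space.rank (Is ! n) (unfolding_mat Is n (all_modes_prod d C U)) = rs ! n"
  shows "unfolding_mat (rs[n := Is ! n]) n (other_modes_prod d n (tangent dC dU - A) UT) *
      (unfolding_mat rs n C)\<^sup>T = 0\<^sub>m (Is ! n) (rs ! n) \<longleftrightarrow> factor_eq Is rs C U A dC dU n"
proof -
  let ?K = "unfolding_mat rs n C" and ?N = "prod_list (del_mode n rs)"
  let ?S = "\<Sum>k\<in>{..<d} - {n}. mode_prod C k ((U k)\<^sup>T * dU k)"
  let ?B = "unfolding_mat (rs[n := Is ! n]) n (other_modes_prod d n A UT)"
  have n': "n < length rs" using n length_rs by simp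
  have K: "?K \<in> carrier_mat (rs ! n) ?N" by (rule unfolding_mat_carrier)
  have B: "?B \<in> carrier_mat (Is ! n) ?N" using n' by (intro carrier_matI) simp_all
  note dUn = tangent_dirs_carrier[OF dU n]
  have UX: "U n * unfolding_mat rs n X \<in> carrier_mat (Is ! n) ?N" for X
    by (rule mult_carrier_mat[OF U_carrier[OF n] unfolding_mat_carrier])
  have KK: "?K * ?K\<^sup>T \<in> carrier_mat (rs ! n) (rs ! n)" by (intro carrier_matI) simp_all
  obtain H where H: "mat_inverse (?K * ?K\<^sup>T) = Some H" "H \<in> carrier_mat (rs ! n) (rs ! n)"
    "?K * ?K\<^sup>T * H = 1\<^sub>m (rs ! n)" "H * (?K * ?K\<^sup>T) = 1\<^sub>m (rs ! n)"
    using invertible_matE[OF KK core_gram_det[OF n rank]] by blast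
  have "other_modes_prod d n (tangent dC dU - A) UT =
      mode_prod dC n (U n) + mode_prod C n (dU n) + mode_prod ?S n (U n) - other_modes_prod d n A UT"
    unfolding other_modes_UT_tangent[OF assms(1-3), symmetric]
    by (simp only: other_modes_prod_def mode_prods_diff)
  then have "unfolding_mat (rs[n := Is ! n]) n (other_modes_prod d n (tangent dC dU - A) UT) =
      U n * unfolding_mat rs n dC + dU n * ?K + U n * unfolding_mat rs n ?S - ?B"
    by (simp only: unfolding_mat_add unfolding_mat_diff
        unfolding_mode_prod[OF n' U_carrier[OF n]] unfolding_mode_prod[OF n' dUn])
  then show ?thesis
    using normal_equation_iff[OF B UX UX dUn K H(2-4)]
    by (simp only: factor_eq_def factor_sum_unfolding H(1) option.sel length_Is)
qed

lemma minimizer_iff: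
  assumes "0 < d" "A \<in> tensors Is" "dC \<in> tensors rs" "dU \<in> tangent_dirs"
    and rank: "\<And>n. n < d \<Longrightarrow> vec_space.rank (Is ! n) (unfolding_mat Is n (all_modes_prod d C U)) = rs ! n"
  shows "is_arg_min (\<lambda>Z. tensor_norm Is (Z - A)) (\<lambda>Z. Z \<in> tucker_tangent_space Is rs C U) (tangent dC dU)
    \<longleftrightarrow> core_eq d C U A dC dU \<and> (\<forall>n<d. factor_eq Is rs C U A dC dU n)"
proof -
  have Y: "tangent dC dU \<in> tucker_tangent_space Is rs C U"
    by (rule tangent_memI[OF assms(3,4)])
  have "tangent dC dU \<in> tensors Is"
    unfolding tangent_tensor_def
  proof (intro tensors_add tensors_sum all_modes_closed C assms(3) U_carrier)
    fix k n assume "k \<in> {..<d}" "n < d"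
    then show "(U(k := dU k)) n \<in> carrier_mat (Is ! n) (rs ! n)"
      using tangent_dirs_carrier[OF assms(4)] U_carrier by simp
  qed
  then have R: "tangent dC dU - A \<in> tensors Is"
    using assms(2) by (rule tensors_diff)
  show ?thesis
    \<comment> \<open>The congruence rule makes \<open>n < d\<close> available where the rank
      condition and the factor equation of mode \<open>n\<close> are used.\<close>
    by (simp only: is_arg_min_tensor_norm_iff[OF Y tangent_space_linear] tangent_space_orthogonal_iff[OF R]
        core_eq_iff[OF assms(1,3,4)] factor_eq_iff[OF _ assms(3,4) rank] cong: imp_cong)
qed

text \<open>The orthogonality removes all sums over the other factors. What remains of the core
  equation turns \<open>U n\<close> times the unfolded \<open>dC\<close> into the projector
  \<open>U n * (U n)\<^sup>T\<close> applied to the data, so the factor equations are compared with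
  the core equation in hand.\<close>

lemma reduced_iff:
  assumes orth: "\<And>n. n < d \<Longrightarrow> (U n)\<^sup>T * dU n = 0\<^sub>m (rs ! n) (rs ! n)"
  shows "core_eq d C U A dC dU \<and> (\<forall>n<d. factor_eq Is rs C U A dC dU n)
    \<longleftrightarrow> reduced_core_eq d U A dC \<and> (\<forall>n<d. reduced_factor_eq Is rs C U A dU n)"
proof -
  have zero: "(\<Sum>k\<in>K. mode_prod C k ((U k)\<^sup>T * dU k)) = 0" if "K \<subseteq> {..<d}" for K
  proof (intro sum.neutral ballI)
    fix k assume "k \<in> K"
    then have "k < d" using that by auto
    then show "mode_prod C k ((U k)\<^sup>T * dU k) = 0"
      by (simp only: orth mode_prod_zero_right)
  qed
  have core: "core_eq d C U A dC dU \<longleftrightarrow> reduced_core_eq d U A dC"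
    by (simp only: core_eq_def reduced_core_eq_def zero[OF subset_refl] diff_zero)
  have "factor_eq Is rs C U A dC dU n \<longleftrightarrow> reduced_factor_eq Is rs C U A dU n"
    if red: "reduced_core_eq d U A dC" and n: "n < d" for n
  proof -
    let ?B = "unfolding_mat (rs[n := Is ! n]) n (other_modes_prod d n A UT)"
    let ?N = "prod_list (del_mode n rs)"
    note Un = U_carrier[OF n] and UTn = UT_carrier[OF n]
    have n': "n < length (rs[n := Is ! n])" using n length_rs by simp
    have B: "?B \<in> carrier_mat (Is ! n) ?N" using n' by (intro carrier_matI) simp_all
    \<comment> \<open>The full projection of \<open>A\<close> is the projection along the other
      modes followed by the one in mode \<open>n\<close>.\<close>
    have "unfolding_mat rs n dC = (U n)\<^sup>T * ?B"
      using unfolding_mode_prod[OF n', of "(U n)\<^sup>T" "rs ! n"] UTn n' red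
      by (simp add: reduced_core_eq_def all_modes_UT_split[OF n])
    then have "U n * unfolding_mat rs n dC = U n * (U n)\<^sup>T * ?B"
      using assoc_mult_mat[OF Un UTn B] by simp
    moreover have UUB: "U n * (U n)\<^sup>T * ?B \<in> carrier_mat (Is ! n) ?N"
      by (rule mult_carrier_mat[OF mult_carrier_mat[OF Un UTn] B])
    moreover have "U n * unfolding_mat rs n 0 = 0\<^sub>m (Is ! n) ?N"
      by (simp only: unfolding_mat_zero right_mult_zero_mat[OF Un])
    moreover have "X - 0\<^sub>m (Is ! n) ?N = X" if "X \<in> carrier_mat (Is ! n) ?N" for X :: "real mat"
      using that by (intro eq_matI) auto
    moreover have "(1\<^sub>m (Is ! n) - U n * (U n)\<^sup>T) * ?B = ?B - U n * (U n)\<^sup>T * ?B"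
      using minus_mult_distrib_mat[OF one_carrier_mat mult_carrier_mat[OF Un UTn] B]
        left_mult_one_mat[OF B] by simp
    ultimately show ?thesis
      by (simp only: factor_eq_def reduced_factor_eq_def factor_sum_unfolding zero[OF Diff_subset]
          minus_carrier_mat[OF UUB] length_Is)
  qed
  with core show ?thesis by blast
qed

end

theorem theorem2:
  fixes d :: nat and Is rs :: "nat list"
    and C A dC :: tensor and U dU :: "nat \<Rightarrow> real mat"
  assumes "2 \<le> d" and "length Is = d" and "length rs = d"
    and "C \<in> tensors rs"
    and "\<forall>n<d. U n \<in> stiefel (Is ! n) (rs ! n)"
    and "all_modes_prod d C U \<in> tucker_manifold Is rs"
    and "A \<in> tensors Is"
    and "dC \<in> tensors rs"
    and "\<forall>n<d. dU n \<in> stiefel_tangent (Is ! n) (rs ! n) (U n)"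
  shows "(is_arg_min (\<lambda>Z. tensor_norm Is (Z - A)) (\<lambda>Z. Z \<in> tucker_tangent_space Is rs C U)
            (tangent_tensor d C U dC dU)
          \<longleftrightarrow> core_eq d C U A dC dU \<and> (\<forall>n<d. factor_eq Is rs C U A dC dU n))
       \<and> ((\<forall>n<d. (U n)\<^sup>T * dU n = 0\<^sub>m (rs ! n) (rs ! n)) \<longrightarrow>
            (core_eq d C U A dC dU \<and> (\<forall>n<d. factor_eq Is rs C U A dC dU n)
             \<longleftrightarrow> reduced_core_eq d U A dC \<and> (\<forall>n<d. reduced_factor_eq Is rs C U A dU n)))"
proof -
  interpret tucker_factors Is rs d C U
    using assms(2-5) by unfold_locales auto
  have dU: "dU \<in> tangent_dirs" using assms(9) by simp
  have d: "0 < d" using assms(1) by simp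
  have rank: "vec_space.rank (Is ! n) (unfolding_mat Is n (all_modes_prod d C U)) = rs ! n" if "n < d" for n
    using assms(2,6) that by (simp add: tucker_manifold_def)
  show ?thesis
  proof (intro conjI impI)
    assume "\<forall>n<d. (U n)\<^sup>T * dU n = 0\<^sub>m (rs ! n) (rs ! n)"
    then show "core_eq d C U A dC dU \<and> (\<forall>n<d. factor_eq Is rs C U A dC dU n)
        \<longleftrightarrow> reduced_core_eq d U A dC \<and> (\<forall>n<d. reduced_factor_eq Is rs C U A dU n)"
      by (intro reduced_iff) blast
  qed (rule minimizer_iff[OF d assms(7,8) dU rank])
qed

end
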